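(* For fixed $\sigma\ne1$, there exist constants $C_1(\sigma),C_2(\sigma)\in\mathbb{R}$ such that all zeros $k$ of $f(\cdot;\sigma)$ (defined in the context) satisfy $$C_1(\sigma)<\operatorname{Im}k<C_2(\sigma).$$ If $\delta\in\mathbb{R}_+$ (where $\sigma=\delta/r$), one can set $C_2(\sigma)=0$. Moreover, for any $x_1<x_2$, define the number of zeros of $f(\cdot;\sigma)$ in the rectangle $[x_1,x_2]\times[C_1(\sigma),C_2(\sigma)]$ by $$n(x_1,x_2)=\#\{k\in\mathbb{C}\mid f(k;\sigma)=0,\ x_1<\operatorname{Re}k<x_2,\ C_1(\sigma)<\operatorname{Im}k<C_2(\sigma)\}.$$ Then $$\lim_{x_2-x_1\to+\infty}\frac{n(x_1,x_2)}{x_2-x_1}=\frac{\|\boldsymbol t\|_1}{\pi}.$$ In particular, $f(\cdot;\sigma)$ possesses countably many zeros and consequently the scattering problem $(\mathrm{SP}_\delta)$ admits countably many resonant frequencies.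
   Context: Setting. There are $N$ resonators $(x_j^-,x_j^+)\subset\mathbb{R}$, $1\le j\le N$, with $x_j^-<x_j^+<x_{j+1}^-$; $D=\bigcup_{j=1}^N(x_j^-,x_j^+)$, $\ell_j=x_j^+-x_j^-$, $s_j=x_{j+1}^--x_j^+$. $v$ and $v_b$ are the wave speeds outside and inside $D$, $r=v/v_b$ is a fixed positive constant, $\delta\in\mathbb{C}$ is the density ratio, and $\sigma=\delta/r$. For $\omega\in\mathbb{C}$ put $k=\omega/v$ and $k_b=\omega/v_b=rk$. $w|_\pm(x)=\lim_{s\to0^+}w(x\pm s)$. The scattering problem $(\mathrm{SP}_\delta)$ is: $u''+k^2u=0$ on $\mathbb{R}\setminus D$; $u''+k_b^2u=0$ on $D$; for all $1\le j\le N$: $u|_+(x_j^\pm)=u|_-(x_j^\pm)$, $u'|_+(x_j^-)=\delta\,u'|_-(x_j^-)$, $u'|_-(x_j^+)=\delta\,u'|_+(x_j^+)$; and $\left(\frac{d}{d|x|}-ik\right)u=0$ for $x\in(-\infty,x_1^-)\cup(x_N^+,+\infty)$. $\omega$ is a resonant frequency if this problem has a non-trivial solution $u$. $\boldsymbol t=(t_1,\dots,t_{2N-1})=(r\ell_1,s_1,r\ell_2,s_2,\dots,r\ell_{N-1},s_{N-1},r\ell_N)\in\mathbb{R}_{>0}^{2N-1}$, $\|\boldsymbol t\|_1=\sum_jt_j$, and $$f(k;\sigma)=\sum_{\boldsymbol\alpha\in\{-1,1\}^{2N-1}}(-1)^{\sum_{j=1}^{2N}j\,\epsilon_{\alpha_j,\alpha_{j-1}}}\left(\frac{1-\sigma}{1+\sigma}\right)^{\sum_{j=1}^{2N}\epsilon_{\alpha_j,\alpha_{j-1}}}e^{i\langle\boldsymbol\alpha,\boldsymbol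 t\rangle k},$$ with $\boldsymbol\alpha=(\alpha_1,\dots,\alpha_{2N-1})$, $\alpha_0=\alpha_{2N}=-1$, $\epsilon_{a,b}=1$ if $a\neq b$ and $0$ if $a=b$, $\langle\boldsymbol\alpha,\boldsymbol t\rangle=\sum_j\alpha_jt_j$. A nonzero $\omega=kv$ is a resonant frequency if and only if $f(k;\sigma)=0$.
   Formalization: Zeros in n(x1,x2) are counted with multiplicity, since the limit fails for distinct zeros (e.g. σ=0, N=2, equal t_j: every zero is triple); σ≠-1 is also assumed, because f(k;σ) is undefined at σ=-1. *)

theory Defs
  imports "HOL-Complex_Analysis.Complex_Analysis"
begin

text \<open>Resonators are indexed by \<open>1, \<dots>, N\<close>; the \<open>j\<close>-th one is the interval from \<open>xm j\<close> to \<open>xp j\<close>.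
  Values of \<open>xm\<close>, \<open>xp\<close> outside \<open>{1..N}\<close> are irrelevant.\<close>

definition resonator_chain :: "nat \<Rightarrow> (nat \<Rightarrow> real) \<Rightarrow> (nat \<Rightarrow> real) \<Rightarrow> bool" where
  "resonator_chain N xm xp \<longleftrightarrow>
     1 \<le> N \<and> (\<forall>j\<in>{1..N}. xm j < xp j) \<and> (\<forall>j\<in>{1..<N}. xp j < xm (j + 1))"

definition resonators :: "nat \<Rightarrow> (nat \<Rightarrow> real) \<Rightarrow> (nat \<Rightarrow> real) \<Rightarrow> real set" where
  "resonators N xm xp = (\<Union>j\<in>{1..N}. {xm j<..<xp j})"

definition helmholtz_on :: "real set \<Rightarrow> complex \<Rightarrow> (real \<Rightarrow> complex) \<Rightarrow> bool" where
  "helmholtz_on S \<kappa> u \<longleftrightarrow>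
     (\<forall>x\<in>S. u differentiable at x \<and>
            (\<lambda>y. vector_derivative u (at y)) differentiable at x \<and>
            vector_derivative (\<lambda>y. vector_derivative u (at y)) (at x) + \<kappa>\<^sup>2 * u x = 0)"

text \<open>\<open>flux_jump \<delta> u F G\<close>: the limits of the derivative of \<open>u\<close> along \<open>F\<close> and \<open>G\<close> exist, and
  the former is \<open>\<delta>\<close> times the latter.\<close>

definition flux_jump :: "complex \<Rightarrow> (real \<Rightarrow> complex) \<Rightarrow> real filter \<Rightarrow> real filter \<Rightarrow> bool" where
  "flux_jump \<delta> u F G \<longleftrightarrow>
     (\<exists>a b. ((\<lambda>y. vector_derivative u (at y)) \<longlongrightarrow> a) F \<and>
            ((\<lambda>y. vector_derivative u (at y)) \<longlongrightarrow> b) G \<and> a = \<delta> * b)"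

text \<open>The scattering problem. The equation outside the resonators is imposed away from the
  interface points, where only the transmission conditions hold. The condition that both
  one-sided limits of \<open>u\<close> agree there is stated as continuity, that is, \<open>u\<close> takes the common
  limit as its value; otherwise a function supported on the interface points would count as a
  non-trivial solution. In the radiation condition \<open>d/d|x|\<close> is the derivative pointing away from
  the resonators, wherever the origin is.\<close>

definition scattering_solution ::
  "nat \<Rightarrow> (nat \<Rightarrow> real) \<Rightarrow> (nat \<Rightarrow> real) \<Rightarrow> real \<Rightarrow> real \<Rightarrow> complex \<Rightarrow> complex \<Rightarrow> (real \<Rightarrow> complex) \<Rightarrow> bool"
where
  "scattering_solution N xm xp v vb \<delta> \<omega> u \<longleftrightarrow>
     (let k = \<omega> / of_real v; kb = \<omega> / of_real vb; D = resonators N xm xp in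
        helmholtz_on (interior (- D)) k u \<and>
        helmholtz_on D kb u \<and>
        (\<forall>j\<in>{1..N}.
           isCont u (xm j) \<and> isCont u (xp j) \<and>
           flux_jump \<delta> u (at_right (xm j)) (at_left (xm j)) \<and>
           flux_jump \<delta> u (at_left (xp j)) (at_right (xp j))) \<and>
        (\<forall>x<xm 1. - vector_derivative u (at x) - \<i> * k * u x = 0) \<and>
        (\<forall>x>xp N. vector_derivative u (at x) - \<i> * k * u x = 0))"

definition resonant_frequency ::
  "nat \<Rightarrow> (nat \<Rightarrow> real) \<Rightarrow> (nat \<Rightarrow> real) \<Rightarrow> real \<Rightarrow> real \<Rightarrow> complex \<Rightarrow> complex \<Rightarrow> bool"
where
  "resonant_frequency N xm xp v vb \<delta> \<omega> \<longleftrightarrow>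
     (\<exists>u. scattering_solution N xm xp v vb \<delta> \<omega> u \<and> (\<exists>x. u x \<noteq> 0))"

text \<open>The vector \<open>t\<close>, used at the indices \<open>1, \<dots>, 2N - 1\<close>: \<open>t (2j - 1)\<close> is \<open>r\<close> times the length of the
  \<open>j\<close>-th resonator and \<open>t (2j)\<close> is the gap between the \<open>j\<close>-th and the next one.\<close>

definition travel_times :: "real \<Rightarrow> (nat \<Rightarrow> real) \<Rightarrow> (nat \<Rightarrow> real) \<Rightarrow> nat \<Rightarrow> real" where
  "travel_times r xm xp i =
     (if odd i then r * (xp ((i + 1) div 2) - xm ((i + 1) div 2))
      else xm (i div 2 + 1) - xp (i div 2))"

text \<open>Sign vectors with the convention that the entries with index \<open>0\<close> and \<open>2N\<close> are \<open>-1\<close> (as are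
  all other entries outside \<open>{1..2N - 1}\<close>, so that each vector has exactly one representative).\<close>

definition sign_vectors :: "nat \<Rightarrow> (nat \<Rightarrow> int) set" where
  "sign_vectors N =
     {\<alpha>. \<forall>j. (j \<in> {1..2 * N - 1} \<longrightarrow> \<alpha> j \<in> {-1, 1}) \<and> (j \<notin> {1..2 * N - 1} \<longrightarrow> \<alpha> j = -1)}"

lemma finite_sign_vectors: "finite (sign_vectors N)"
  unfolding sign_vectors_def by (rule finite_set_of_finite_funs) auto

definition sign_change :: "(nat \<Rightarrow> int) \<Rightarrow> nat \<Rightarrow> nat" where
  "sign_change \<alpha> j = (if \<alpha> j \<noteq> \<alpha> (j - 1) then 1 else 0)"

definition resonance_fun :: "nat \<Rightarrow> (nat \<Rightarrow> real) \<Rightarrow> complex \<Rightarrow> complex \<Rightarrow> complex" where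
  "resonance_fun N t \<sigma> k =
     (\<Sum>\<alpha>\<in>sign_vectors N.
        (-1) ^ (\<Sum>j=1..2 * N. j * sign_change \<alpha> j) *
        ((1 - \<sigma>) / (1 + \<sigma>)) ^ (\<Sum>j=1..2 * N. sign_change \<alpha> j) *
        exp (\<i> * of_real (\<Sum>j=1..2 * N - 1. of_int (\<alpha> j) * t j) * k))"

definition zeros_in_strip :: "(complex \<Rightarrow> complex) \<Rightarrow> real \<Rightarrow> real \<Rightarrow> bool" where
  "zeros_in_strip g C1 C2 \<longleftrightarrow> (\<forall>k. g k = 0 \<longrightarrow> C1 < Im k \<and> Im k < C2)"

text \<open>Zeros are counted with multiplicity. The asymptotic density below fails for the number of
  distinct zeros: for three equal entries \<open>t 1 = t 2 = t 3\<close> (so \<open>N = 2\<close>) and \<open>\<sigma> = 0\<close>, every zero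
  is triple.\<close>

definition zero_count :: "(complex \<Rightarrow> complex) \<Rightarrow> real \<Rightarrow> real \<Rightarrow> real \<Rightarrow> real \<Rightarrow> int" where
  "zero_count g C1 C2 x1 x2 =
     (\<Sum>k | g k = 0 \<and> x1 < Re k \<and> Re k < x2 \<and> C1 < Im k \<and> Im k < C2. zorder g k)"

end

theory Submission
  imports Defs
begin

text \<open>
  The resonance function is a finite exponential sum \<open>\<Sum>\<alpha>. c\<^sub>\<alpha> exp (\<i> \<mu>\<^sub>\<alpha> k)\<close> whose real frequencies
  \<open>\<mu>\<^sub>\<alpha> = \<langle>\<alpha>, t\<rangle>\<close> have a unique minimum \<open>-\<parallel>t\<parallel>\<^sub>1\<close> (all signs \<open>-1\<close>) and a unique maximum \<open>\<parallel>t\<parallel>\<^sub>1\<close>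
  (all signs \<open>+1\<close>), both with nonzero coefficient because \<open>\<sigma> \<noteq> 1\<close>. Far up in the complex plane the
  term of lowest frequency outweighs all others together, far down the term of highest frequency
  does (\<open>both_dominate\<close>); hence the zeros lie in a horizontal strip.

  The zeros between two vertical lines are counted by the argument principle on a rectangle of fixed
  height. On a horizontal side the function is an exponential \<open>c exp (\<i> \<mu> k)\<close> times a factor within
  distance \<open>1/2\<close> of \<open>1\<close>; the logarithmic derivative integrates to \<open>\<plusminus> \<i> \<mu>\<close> times the length of
  the side up to a bounded error. The two horizontal sides together give \<open>2 \<i> \<parallel>t\<parallel>\<^sub>1 (x\<^sub>2 - x\<^sub>1)\<close>.
  The vertical sides contribute a bounded amount if the function is bounded away from zero
  on them, with a bound that is the same for all sides. Such lines exist in every interval of length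
  \<open>1\<close> (\<open>good_vertical_lines\<close>): by Montel's theorem horizontal translates of the function form a
  compact family whose members do not vanish identically. So the number of zeros is
  \<open>\<parallel>t\<parallel>\<^sub>1 / \<pi> (x\<^sub>2 - x\<^sub>1)\<close> up to a bounded error (\<open>zero_count_linear\<close>), which gives the density and,
  as \<open>\<parallel>t\<parallel>\<^sub>1 > 0\<close>, infinitely many zeros.

  The remaining claims rest on a recursion. Cutting the sum over sign vectors after the first \<open>n\<close>
  signs and sorting by the next sign gives two sequences of partial sums, and adding one more sign
  multiplies the pair by a \<open>2 \<times> 2\<close> matrix (\<open>layer_sum_Suc\<close>). For real positive \<open>\<delta>\<close> the reflection
  coefficient \<open>\<rho> = (1 - \<sigma>) / (1 + \<sigma>)\<close> is real with \<open>\<bar>\<rho>\<bar> < 1\<close>, and in the closed upper half plane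
  each such step keeps the first entry strictly larger in modulus than the second one, so the
  resonance function has no zero there.

  For \<open>\<omega> \<noteq> 0\<close> a solution of the scattering problem is, in every layer, a superposition of a
  left-going and a right-going plane wave, and the transmission conditions relate the amplitudes in
  neighbouring layers. For \<open>\<sigma> \<noteq> 0\<close> they determine them from left to right by the same \<open>2 \<times> 2\<close>
  matrices up to nonzero factors, so \<open>\<omega>\<close> is resonant exactly if the resonance function vanishes at
  \<open>\<omega> / v\<close>. For \<open>\<sigma> = 0\<close> the flux inside a resonator vanishes at its ends, amplitudes can no longer be
  propagated across a resonator, and the layers decouple: every resonance satisfies
  \<open>sin (t\<^sub>j k) = 0\<close> for some \<open>j\<close>, and every nonzero zero of \<open>sin (t\<^sub>1 k)\<close> is a resonance.
\<close>

section \<open>Argument principle on rectangles\<close>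

text \<open>The zeros of an entire function in the whole plane need not be finite in number, so the
  argument principle is applied in a ball around the rectangle.\<close>

lemma rectangle_argument_principle:
  fixes g :: "complex \<Rightarrow> complex"
  assumes hol: "g holomorphic_on UNIV"
    and le: "Re a < Re b" "Im a < Im b"
    and nz: "\<And>z. z \<in> cbox a b - box a b \<Longrightarrow> g z \<noteq> 0"
  shows "contour_integral (rectpath a b) (\<lambda>z. deriv g z / g z) =
           2 * pi * \<i> * of_int (\<Sum>z | z \<in> box a b \<and> g z = 0. zorder g z)"
proof -
  have "bounded (cbox a b)" by (rule bounded_cbox)
  then obtain R where "cbox a b \<subseteq> ball 0 R"
    using bounded_subset_ballD by blast
  define S where "S = ball (0::complex) R"
  have sub: "cbox a b \<subseteq> S" using \<open>cbox a b \<subseteq> ball 0 R\<close> by (simp add: S_def)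
  have corner: "a \<in> cbox a b - box a b"
    using le by (auto simp: in_cbox_complex_iff in_box_complex_iff)
  have nonconst: "\<not> g constant_on UNIV" if "z \<in> S" "g z = 0" for z
    using nz[OF corner] that by (metis UNIV_I constant_on_def)
  have fin: "finite {z\<in>S. g z = 0}"
  proof (cases "\<exists>z\<in>S. g z = 0")
    case True
    then have "\<not> g constant_on UNIV" using nonconst by blast
    then have "finite {z\<in>cball 0 R. g z = 0}"
      using holomorphic_compact_finite_zeros[OF hol, of "cball 0 R"] by auto
    then show ?thesis by (rule finite_subset[rotated]) (auto simp: S_def)
  next
    case False
    then have "{z\<in>S. g z = 0} = {}" by blast
    then show ?thesis by (metis finite.emptyI)
  qed
  have img: "path_image (rectpath a b) = cbox a b - box a b"
    using path_image_rectpath_cbox_minus_box[of a b] le by simp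
  have "contour_integral (rectpath a b) (\<lambda>z. deriv g z * 1 / g z) = 2 * pi * \<i> *
          (\<Sum>p\<in>{z\<in>S. g z = 0 \<or> z \<in> {}}. winding_number (rectpath a b) p * 1 * zorder g p)"
  proof (rule argument_principle)
    show "path_image (rectpath a b) \<subseteq> S - {z\<in>S. g z = 0 \<or> z \<in> {}}"
      using nz sub unfolding img by auto
    show "\<forall>z. z \<notin> S \<longrightarrow> winding_number (rectpath a b) z = 0"
      using winding_number_rectpath_outside[of a b] le sub by auto
  qed (use fin hol in \<open>auto simp: S_def intro: holomorphic_on_subset\<close>)
  also have "(\<Sum>p\<in>{z\<in>S. g z = 0 \<or> z \<in> {}}. winding_number (rectpath a b) p * 1 * zorder g p)
           = (\<Sum>p\<in>{z. z \<in> box a b \<and> g z = 0}. of_int (zorder g p))"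
  proof (rule sum.mono_neutral_cong_right)
    show "finite {z \<in> S. g z = 0 \<or> z \<in> {}}" using fin by simp
    show "{z \<in> box a b. g z = 0} \<subseteq> {z \<in> S. g z = 0 \<or> z \<in> {}}"
      using sub box_subset_cbox[of a b] by auto
    show "\<forall>p\<in>{z \<in> S. g z = 0 \<or> z \<in> {}} - {z \<in> box a b. g z = 0}.
            winding_number (rectpath a b) p * 1 * of_int (zorder g p) = 0"
      using winding_number_rectpath_outside[of a b] nz le by auto
  qed (simp add: winding_number_rectpath)
  finally show ?thesis by simp
qed

text \<open>Writing \<open>g u = c exp (\<i> m u) q u\<close>, the logarithmic derivative of \<open>g\<close> is that of the exponential
  plus the derivative of \<open>Ln \<circ> q\<close>. The latter integrates to a difference of two values of \<open>Ln\<close> near \<open>1\<close>,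
  however long the segment is; this keeps the error bounded.\<close>

lemma log_deriv_integral_dominated:
  fixes g :: "complex \<Rightarrow> complex"
  assumes hol: "g holomorphic_on UNIV" and c: "c \<noteq> 0"
    and dom: "\<And>z. z \<in> H \<Longrightarrow> norm (g z / (c * exp (\<i> * of_real m * z)) - 1) < 1/2"
    and seg: "closed_segment w z \<subseteq> H"
  shows "\<exists>e. norm e \<le> 2 \<and>
           ((\<lambda>u. deriv g u / g u) has_contour_integral (\<i> * of_real m * (z - w) + e)) (linepath w z)"
proof -
  define q where "q u = g u / (c * exp (\<i> * of_real m * u))" for u
  have q: "norm (q u - 1) < 1/2" if "u \<in> H" for u
    using dom[OF that] by (simp add: q_def)
  have Re_q: "Re (q u) > 0" if "u \<in> H" for u
    using q[OF that] abs_Re_le_cmod[of "q u - 1"] by auto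
  have Ln_q: "norm (Ln (q u)) \<le> 1" if "u \<in> H" for u
    using norm_Ln_le[of "q u - 1"] q[OF that] by simp
  have nonpos: "q u \<notin> \<real>\<^sub>\<le>\<^sub>0" if "u \<in> H" for u
    using Re_q[OF that] by (auto simp: complex_nonpos_Reals_iff)
  have gnz: "g u \<noteq> 0" if "u \<in> H" for u
    using Re_q[OF that] by (auto simp: q_def)
  have "((\<lambda>u. \<i> * of_real m * u + Ln (q u)) has_field_derivative deriv g u / g u) (at u within H)"
    if u: "u \<in> H" for u
  proof -
    have dg: "(g has_field_derivative deriv g u) (at u)"
      using holomorphic_derivI[OF hol] by auto
    have "(q has_field_derivative (deriv g u - \<i> * of_real m * g u) / (c * exp (\<i> * of_real m * u))) (at u)"
      unfolding q_def using c
      by (auto intro!: derivative_eq_intros dg simp: field_simps)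
    then have "((\<lambda>u. Ln (q u)) has_field_derivative
        inverse (q u) * ((deriv g u - \<i> * of_real m * g u) / (c * exp (\<i> * of_real m * u)))) (at u)"
      by (rule DERIV_chain2[where f = Ln and g = q, OF has_field_derivative_Ln[OF nonpos[OF u]]])
    moreover have "inverse (q u) * ((deriv g u - \<i> * of_real m * g u) / (c * exp (\<i> * of_real m * u)))
        = deriv g u / g u - \<i> * of_real m"
      using gnz[OF u] c by (simp add: q_def field_simps)
    ultimately have "((\<lambda>u. Ln (q u)) has_field_derivative (deriv g u / g u - \<i> * of_real m)) (at u)"
      by simp
    from DERIV_add[OF DERIV_cmult_Id[of "\<i> * of_real m"] this]
    have "((\<lambda>u. \<i> * of_real m * u + Ln (q u)) has_field_derivative deriv g u / g u) (at u)"
      by simp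
    then show ?thesis by (rule has_field_derivative_at_within)
  qed
  from contour_integral_primitive[OF this, of "linepath w z"] seg
  have "((\<lambda>u. deriv g u / g u) has_contour_integral
          (\<i> * of_real m * (z - w) + (Ln (q z) - Ln (q w)))) (linepath w z)"
    by (simp add: algebra_simps)
  moreover have "norm (Ln (q z) - Ln (q w)) \<le> 2"
    using Ln_q[of z] Ln_q[of w] seg norm_triangle_ineq4[of "Ln (q z)" "Ln (q w)"]
    by (auto simp: subset_iff)
  ultimately show ?thesis by blast
qed

section \<open>Zeros of exponential sums\<close>

locale exponential_sum =
  fixes A :: "'a set" and c :: "'a \<Rightarrow> complex" and \<mu> :: "'a \<Rightarrow> real" and lo hi :: 'a
  assumes finite_A: "finite A"
    and lo: "lo \<in> A" "c lo \<noteq> 0" "\<And>a. a \<in> A \<Longrightarrow> a \<noteq> lo \<Longrightarrow> \<mu> lo < \<mu> a"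
    and hi: "hi \<in> A" "c hi \<noteq> 0" "\<And>a. a \<in> A \<Longrightarrow> a \<noteq> hi \<Longrightarrow> \<mu> a < \<mu> hi"
    and lo_less_hi: "\<mu> lo < \<mu> hi"
begin

definition g :: "complex \<Rightarrow> complex" where
  "g z = (\<Sum>a\<in>A. c a * exp (\<i> * of_real (\<mu> a) * z))"

lemma holomorphic_g: "g holomorphic_on S"
  unfolding g_def by (intro holomorphic_intros)

lemma norm_exp_mu: "norm (exp (\<i> * of_real m * z)) = exp (- m * Im z)"
  by simp

text \<open>After division by the term of lowest frequency, each other term has modulus
  \<open>\<bar>c a / c lo\<bar> exp (- (\<mu> a - \<mu> lo) Im z)\<close>, which tends to \<open>0\<close> as \<open>Im z \<rightarrow> \<infinity>\<close>.\<close>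

lemma lowest_dominates:
  "\<exists>M. \<forall>z. Im z \<ge> M \<longrightarrow> norm (g z / (c lo * exp (\<i> * of_real (\<mu> lo) * z)) - 1) < 1/2"
proof -
  have "((\<lambda>y. \<Sum>a\<in>A-{lo}. norm (c a / c lo) * exp (- (\<mu> a - \<mu> lo) * y)) \<longlongrightarrow> 0) at_top"
  proof (intro tendsto_null_sum tendsto_mult_right_zero)
    fix a assume "a \<in> A - {lo}"
    then have "\<mu> a - \<mu> lo > 0" using lo(3) by auto
    then have "filterlim (\<lambda>y. (\<mu> a - \<mu> lo) * y) at_top at_top"
      by (intro filterlim_tendsto_pos_mult_at_top[OF tendsto_const]) (auto simp: filterlim_ident)
    then have "filterlim (\<lambda>y. - (\<mu> a - \<mu> lo) * y) at_bot at_top"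
      by (simp add: filterlim_uminus_at_bot algebra_simps)
    then show "((\<lambda>y. exp (- (\<mu> a - \<mu> lo) * y)) \<longlongrightarrow> 0) at_top"
      by (rule filterlim_compose[OF exp_at_bot])
  qed
  then have "eventually (\<lambda>y. (\<Sum>a\<in>A-{lo}. norm (c a / c lo) * exp (- (\<mu> a - \<mu> lo) * y)) < 1/2) at_top"
    by (rule order_tendstoD) simp
  then obtain M where M: "\<And>y. y \<ge> M \<Longrightarrow>
      (\<Sum>a\<in>A-{lo}. norm (c a / c lo) * exp (- (\<mu> a - \<mu> lo) * y)) < 1/2"
    by (auto simp: eventually_at_top_linorder)
  have "norm (g z / (c lo * exp (\<i> * of_real (\<mu> lo) * z)) - 1) < 1/2" if "Im z \<ge> M" for z
  proof -
    have "g z = c lo * exp (\<i> * of_real (\<mu> lo) * z) + (\<Sum>a\<in>A-{lo}. c a * exp (\<i> * of_real (\<mu> a) * z))"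
      unfolding g_def using finite_A lo(1) by (simp add: sum.remove)
    then have "g z / (c lo * exp (\<i> * of_real (\<mu> lo) * z)) - 1 =
        (\<Sum>a\<in>A-{lo}. c a * exp (\<i> * of_real (\<mu> a) * z)) / (c lo * exp (\<i> * of_real (\<mu> lo) * z))"
      using lo(2) by (simp add: field_simps)
    also have "\<dots> = (\<Sum>a\<in>A-{lo}. c a / c lo * exp (\<i> * of_real (\<mu> a - \<mu> lo) * z))"
      unfolding sum_divide_distrib
      by (intro sum.cong) (auto simp: algebra_simps exp_diff)
    also have "norm \<dots> \<le> (\<Sum>a\<in>A-{lo}. norm (c a / c lo) * exp (- (\<mu> a - \<mu> lo) * Im z))"
      by (intro order.trans[OF norm_sum] sum_mono) (simp only: norm_mult norm_exp_mu order_refl)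
    also have "\<dots> < 1/2" using M[OF that] .
    finally show ?thesis .
  qed
  then show ?thesis by blast
qed

text \<open>The substitution \<open>z \<mapsto> - z\<close> negates all frequencies and exchanges the two extreme terms.\<close>

lemma highest_dominates:
  "\<exists>M. \<forall>z. Im z \<le> - M \<longrightarrow> norm (g z / (c hi * exp (\<i> * of_real (\<mu> hi) * z)) - 1) < 1/2"
proof -
  interpret refl: exponential_sum A c "\<lambda>a. - \<mu> a" hi lo
    using finite_A lo hi lo_less_hi by unfold_locales auto
  have "refl.g (- z) = g z" for z
    by (simp add: refl.g_def g_def)
  moreover obtain M where
    "\<And>z. Im z \<ge> M \<Longrightarrow> norm (refl.g z / (c hi * exp (\<i> * of_real (- \<mu> hi) * z)) - 1) < 1/2"
    using refl.lowest_dominates by blast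
  from this[of "- _"] have "Im z \<le> - M \<Longrightarrow>
      norm (refl.g (- z) / (c hi * exp (\<i> * of_real (\<mu> hi) * z)) - 1) < 1/2" for z
    by simp
  ultimately show ?thesis by auto
qed

lemma both_dominate:
  obtains M where "M > 0"
    "\<And>z. Im z > M \<Longrightarrow> norm (g z / (c lo * exp (\<i> * of_real (\<mu> lo) * z)) - 1) < 1/2"
    "\<And>z. Im z < - M \<Longrightarrow> norm (g z / (c hi * exp (\<i> * of_real (\<mu> hi) * z)) - 1) < 1/2"
proof -
  obtain M1 where M1: "\<And>z. Im z \<ge> M1 \<Longrightarrow> norm (g z / (c lo * exp (\<i> * of_real (\<mu> lo) * z)) - 1) < 1/2"
    using lowest_dominates by blast
  obtain M2 where M2: "\<And>z. Im z \<le> - M2 \<Longrightarrow> norm (g z / (c hi * exp (\<i> * of_real (\<mu> hi) * z)) - 1) < 1/2"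
    using highest_dominates by blast
  show thesis
  proof (rule that[of "max 1 (max M1 M2)"])
    fix z
    show "norm (g z / (c lo * exp (\<i> * of_real (\<mu> lo) * z)) - 1) < 1/2" if "Im z > max 1 (max M1 M2)"
      by (rule M1) (use that in simp)
    show "norm (g z / (c hi * exp (\<i> * of_real (\<mu> hi) * z)) - 1) < 1/2" if "Im z < - max 1 (max M1 M2)"
      by (rule M2) (use that in linarith)
  qed simp
qed

lemma zeros_in_strip_symmetric:
  obtains M where "M > 0" "\<And>z. g z = 0 \<Longrightarrow> \<bar>Im z\<bar> < M"
proof -
  obtain M where M: "M > 0"
    "\<And>z. Im z > M \<Longrightarrow> norm (g z / (c lo * exp (\<i> * of_real (\<mu> lo) * z)) - 1) < 1/2"
    "\<And>z. Im z < - M \<Longrightarrow> norm (g z / (c hi * exp (\<i> * of_real (\<mu> hi) * z)) - 1) < 1/2"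
    using both_dominate by blast
  show thesis
  proof (rule that[of "M + 1"])
    fix z assume "g z = 0"
    then show "\<bar>Im z\<bar> < M + 1"
      using M(2,3)[of z] by force
  qed (use M(1) in simp)
qed

lemma nonzero_somewhere: "\<exists>z. g z \<noteq> 0"
proof -
  obtain M where "M > 0" "\<And>z. g z = 0 \<Longrightarrow> \<bar>Im z\<bar> < M" using zeros_in_strip_symmetric by blast
  from this(2)[of "\<i> * of_real M"] this(1) have "g (\<i> * of_real M) \<noteq> 0" by auto
  then show ?thesis by blast
qed

lemma has_zero_imp_nonconstant: "g w = 0 \<Longrightarrow> \<not> g constant_on UNIV"
  using nonzero_somewhere by (metis UNIV_I constant_on_def)

lemma countable_zeros: "countable {z. g z = 0}"
proof (cases "\<exists>w. g w = 0")
  case True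
  then show ?thesis
    using holomorphic_countable_zeros[OF holomorphic_g open_UNIV connected_UNIV]
      has_zero_imp_nonconstant fsigma_UNIV by force
qed simp

lemma finite_zeros_compact:
  assumes "compact K" shows "finite {z\<in>K. g z = 0}"
proof (cases "\<exists>w. g w = 0")
  case True
  then show ?thesis
    using holomorphic_compact_finite_zeros[OF holomorphic_g open_UNIV connected_UNIV assms]
      has_zero_imp_nonconstant by force
qed simp

lemma finite_zeros_between: "finite {z. g z = 0 \<and> x1 < Re z \<and> Re z < x2}"
proof -
  obtain M where M: "\<And>z. g z = 0 \<Longrightarrow> \<bar>Im z\<bar> < M" using zeros_in_strip_symmetric by blast
  show ?thesis
    by (rule finite_subset[OF _ finite_zeros_compact[OF compact_cbox[of "Complex x1 (-M)" "Complex x2 M"]]])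
      (auto simp: in_cbox_complex_iff dest: M)
qed

lemma zorder_pos_at_zero: "g z = 0 \<Longrightarrow> zorder g z > 0"
  using zorder_exist_zero[OF holomorphic_g open_UNIV connected_UNIV, of z] nonzero_somewhere by auto

lemma norm_g_le: "norm (g z) \<le> (\<Sum>a\<in>A. norm (c a) * exp (\<bar>\<mu> a\<bar> * \<bar>Im z\<bar>))"
  unfolding g_def
proof (intro order.trans[OF norm_sum] sum_mono)
  fix a
  have "- (\<mu> a * Im z) \<le> \<bar>\<mu> a\<bar> * \<bar>Im z\<bar>"
    by (metis abs_ge_minus_self abs_mult)
  then show "norm (c a * exp (\<i> * of_real (\<mu> a) * z)) \<le> norm (c a) * exp (\<bar>\<mu> a\<bar> * \<bar>Im z\<bar>)"
    by (simp add: norm_mult mult_left_mono)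
qed

lemma deriv_g: "deriv g z = (\<Sum>a\<in>A. (c a * (\<i> * of_real (\<mu> a))) * exp (\<i> * of_real (\<mu> a) * z))"
  unfolding g_def
  by (intro DERIV_imp_deriv) (auto intro!: derivative_eq_intros sum.cong)

lemma norm_deriv_g_le:
  "norm (deriv g z) \<le> (\<Sum>a\<in>A. norm (c a) * \<bar>\<mu> a\<bar> * exp (\<bar>\<mu> a\<bar> * \<bar>Im z\<bar>))"
  unfolding deriv_g
proof (intro order.trans[OF norm_sum] sum_mono)
  fix a
  have "- (\<mu> a * Im z) \<le> \<bar>\<mu> a\<bar> * \<bar>Im z\<bar>"
    by (metis abs_ge_minus_self abs_mult)
  then show "norm ((c a * (\<i> * of_real (\<mu> a))) * exp (\<i> * of_real (\<mu> a) * z))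
      \<le> norm (c a) * \<bar>\<mu> a\<bar> * exp (\<bar>\<mu> a\<bar> * \<bar>Im z\<bar>)"
    by (simp add: norm_mult mult_left_mono)
qed

text \<open>If the intervals starting at \<open>a n\<close> violated the claim for smaller and smaller \<open>\<epsilon>\<close>, then by
  Montel's theorem the translates \<open>z \<mapsto> g (z + a n)\<close> would have a subsequence converging locally
  uniformly to an entire function \<open>h\<close>. The limit is not identically zero, because translation does
  not change the modulus of the dominating term high up. So \<open>h\<close> has finitely many zeros in the
  rectangle over \<open>[0, 1]\<close> and is bounded away from zero on some vertical segment in it, and then the
  translates are so, too.\<close>

lemma good_vertical_lines:
  "\<exists>\<epsilon>>0. \<forall>a. \<exists>x\<in>{a..a+1}. \<forall>y\<in>{-M..M}. \<epsilon> \<le> norm (g (Complex x y))"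
proof (rule ccontr)
  assume contr: "\<not> ?thesis"
  have "\<exists>a. \<forall>x\<in>{a..a+1}. \<exists>y\<in>{-M..M}. norm (g (Complex x y)) < inverse (real (Suc n))" for n
  proof -
    have "inverse (real (Suc n)) > 0" by simp
    with contr show ?thesis by (metis not_less)
  qed
  then obtain a where a: "\<And>n x. x \<in> {a n..a n+1} \<Longrightarrow>
      \<exists>y\<in>{-M..M}. norm (g (Complex x y)) < inverse (real (Suc n))"
    by metis
  define F where "F n z = g (z + of_real (a n))" for n z
  have hol: "h holomorphic_on UNIV" if "h \<in> range F" for h
    using that unfolding F_def g_def by (auto intro!: holomorphic_intros)
  have bnd: "\<exists>B. \<forall>h\<in>range F. \<forall>z\<in>K. norm (h z) \<le> B" if "compact K" for K
  proof -
    obtain R where R: "\<And>z. z \<in> K \<Longrightarrow> norm z \<le> R"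
      using compact_imp_bounded[OF \<open>compact K\<close>] by (auto simp: bounded_iff)
    have "norm (F n z) \<le> (\<Sum>a\<in>A. norm (c a) * exp (\<bar>\<mu> a\<bar> * R))" if "z \<in> K" for n z
    proof -
      have "\<bar>Im z\<bar> \<le> R" using R[OF that] abs_Im_le_cmod order.trans by blast
      then have "(\<Sum>a\<in>A. norm (c a) * exp (\<bar>\<mu> a\<bar> * \<bar>Im z\<bar>)) \<le> (\<Sum>a\<in>A. norm (c a) * exp (\<bar>\<mu> a\<bar> * R))"
        by (intro sum_mono mult_left_mono) (auto intro: mult_left_mono)
      with norm_g_le[of "z + of_real (a n)"] show ?thesis by (simp add: F_def)
    qed
    then show ?thesis by blast
  qed
  obtain h r where h: "h holomorphic_on UNIV" "strict_mono (r :: nat \<Rightarrow> nat)"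
      "\<And>z. (\<lambda>n. F (r n) z) \<longlonglongrightarrow> h z"
      "\<And>K. compact K \<Longrightarrow> uniform_limit K (F \<circ> r) h sequentially"
    using Montel[OF open_UNIV hol bnd subset_refl] by auto
  obtain M1 where M1: "\<And>z. Im z > M1 \<Longrightarrow> norm (g z / (c lo * exp (\<i> * of_real (\<mu> lo) * z)) - 1) < 1/2"
    using both_dominate by metis
  \<comment> \<open>a height at which all translates are uniformly bounded below\<close>
  define w where "w = \<i> * of_real (M1 + 1)"
  define d where "d = norm (c lo * exp (\<i> * of_real (\<mu> lo) * w)) / 2"
  have "d > 0" using lo(2) by (simp add: d_def)
  have "d \<le> norm (F n w)" for n
  proof -
    define E where "E = c lo * exp (\<i> * of_real (\<mu> lo) * (w + of_real (a n)))"
    have E: "E \<noteq> 0" "norm E = 2 * d" using lo(2) by (auto simp: E_def d_def norm_mult)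
    have "norm (g (w + of_real (a n)) / E - 1) < 1/2"
      unfolding E_def by (rule M1) (simp add: w_def)
    then have "norm (F n w / E) > 1/2"
      using norm_triangle_ineq4[of "F n w / E" "F n w / E - 1"] by (simp add: F_def)
    then show ?thesis using E \<open>d > 0\<close> by (simp add: norm_divide field_simps)
  qed
  then have "d \<le> norm (h w)"
    by (intro LIMSEQ_le_const[OF tendsto_norm[OF h(3)]]) auto
  with \<open>d > 0\<close> have "h w \<noteq> 0" by auto
  define Q where "Q = cbox (Complex 0 (-M)) (Complex 1 M)"
  have "finite {z\<in>Q. h z = 0}"
  proof (cases "\<exists>z. h z = 0")
    case True
    with \<open>h w \<noteq> 0\<close> have "\<not> h constant_on UNIV" by (metis UNIV_I constant_on_def)
    then show ?thesis
      using holomorphic_compact_finite_zeros[OF h(1) open_UNIV connected_UNIV, of Q] by (simp add: Q_def)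
  qed simp
  then have "infinite ({0..1} - Re ` {z\<in>Q. h z = 0})"
    by (intro Diff_infinite_finite) (auto simp: infinite_Icc)
  then obtain x where x: "x \<in> {0..1}" "x \<notin> Re ` {z\<in>Q. h z = 0}"
    using infinite_imp_nonempty by blast
  define L where "L = (\<lambda>y. Complex x y) ` {-M..M}"
  have cL: "compact L"
    unfolding L_def Complex_eq by (intro compact_continuous_image continuous_intros) auto
  have "L \<subseteq> Q" using x(1) by (auto simp: L_def Q_def in_cbox_complex_iff)
  have hL: "h z \<noteq> 0" if "z \<in> L" for z
  proof
    assume "h z = 0"
    moreover have "z \<in> Q" "Re z = x" using that \<open>L \<subseteq> Q\<close> by (auto simp: L_def)
    ultimately show False using x(2) by force
  qed
  have "\<exists>e>0. \<forall>z\<in>L. e \<le> norm (h z)"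
  proof (cases "L = {}")
    case True
    then show ?thesis by (auto intro: exI[of _ 1])
  next
    case False
    have "continuous_on L (\<lambda>z. norm (h z))"
      using h(1) by (intro continuous_on_norm holomorphic_on_imp_continuous_on)
        (auto intro: holomorphic_on_subset)
    from continuous_attains_inf[OF cL False this] hL show ?thesis
      by (metis zero_less_norm_iff)
  qed
  then obtain e where e: "e > 0" "\<And>z. z \<in> L \<Longrightarrow> e \<le> norm (h z)" by blast
  have "eventually (\<lambda>n. \<forall>z\<in>L. dist (F (r n) z) (h z) < e / 2) sequentially"
    using uniform_limitD[OF h(4)[OF cL], of "e / 2"] e(1) by simp
  moreover have "eventually (\<lambda>n. inverse (real (Suc n)) < e / 2) sequentially"
    using e(1) by (intro order_tendstoD(2)[OF LIMSEQ_inverse_real_of_nat]) auto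
  ultimately have "eventually (\<lambda>n. (\<forall>z\<in>L. dist (F (r n) z) (h z) < e / 2) \<and> inverse (real (Suc n)) < e / 2) sequentially"
    by (rule eventually_conj)
  then obtain n where n: "\<And>z. z \<in> L \<Longrightarrow> dist (F (r n) z) (h z) < e / 2" "inverse (real (Suc n)) < e / 2"
    using eventually_happens'[OF sequentially_bot] by blast
  have "a (r n) + x \<in> {a (r n)..a (r n) + 1}" using x(1) by simp
  then obtain y where y: "y \<in> {-M..M}" "norm (g (Complex (a (r n) + x) y)) < inverse (real (Suc (r n)))"
    using a by blast
  have "Complex x y \<in> L" using y(1) by (simp add: L_def)
  moreover have "F (r n) (Complex x y) = g (Complex (a (r n) + x) y)"
    by (simp add: F_def Complex_eq algebra_simps)
  moreover have "inverse (real (Suc (r n))) \<le> inverse (real (Suc n))"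
    using seq_suble[OF h(2), of n] by (simp add: field_simps)
  with y(2) n(2) have "norm (g (Complex (a (r n) + x) y)) < e / 2" by linarith
  ultimately have "norm (F (r n) (Complex x y)) < e / 2" by simp
  moreover have "e \<le> norm (h (Complex x y))" "norm (F (r n) (Complex x y) - h (Complex x y)) < e / 2"
    using e(2) n(1) \<open>Complex x y \<in> L\<close> by (auto simp: dist_norm)
  ultimately show False
    using norm_triangle_ineq3[of "F (r n) (Complex x y)" "h (Complex x y)"] by linarith
qed

text \<open>The dominance hypotheses start at height \<open>M - 1\<close> so that the horizontal sides at
  heights \<open>M\<close> and \<open>-M\<close> lie in the open half planes where the exponential form is valid.\<close>

lemma zero_count_between_good_lines:
  assumes "M > 0" "\<epsilon> > 0"
  and dom: "\<And>z. Im z > M - 1 \<Longrightarrow> norm (g z / (c lo * exp (\<i> * of_real (\<mu> lo) * z)) - 1) < 1/2"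
    "\<And>z. Im z < - (M - 1) \<Longrightarrow> norm (g z / (c hi * exp (\<i> * of_real (\<mu> hi) * z)) - 1) < 1/2"
  shows "\<exists>K. \<forall>x1 x2. x1 < x2 \<longrightarrow>
     (\<forall>y\<in>{-M..M}. \<epsilon> \<le> norm (g (Complex x1 y))) \<longrightarrow>
     (\<forall>y\<in>{-M..M}. \<epsilon> \<le> norm (g (Complex x2 y))) \<longrightarrow>
     \<bar>real_of_int (\<Sum>z | g z = 0 \<and> x1 < Re z \<and> Re z < x2. zorder g z)
        - (\<mu> hi - \<mu> lo) / (2 * pi) * (x2 - x1)\<bar> \<le> K"
proof -
  define B where "B = (\<Sum>a\<in>A. norm (c a) * \<bar>\<mu> a\<bar> * exp (\<bar>\<mu> a\<bar> * M))"
  have B: "norm (deriv g z) \<le> B" if "\<bar>Im z\<bar> \<le> M" for z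
    unfolding B_def
    by (rule order.trans[OF norm_deriv_g_le])
      (use that in \<open>auto intro!: sum_mono mult_left_mono\<close>)
  have B0: "0 \<le> B" unfolding B_def by (intro sum_nonneg) auto
  define f where "f z = deriv g z / g z" for z
  have vertical: "f contour_integrable_on linepath (Complex x y1) (Complex x y2) \<and>
      norm (contour_integral (linepath (Complex x y1) (Complex x y2)) f) \<le> B / \<epsilon> * (2 * M)"
    if "{y1, y2} = {-M, M}" and good: "\<forall>y\<in>{-M..M}. \<epsilon> \<le> norm (g (Complex x y))" for x y1 y2
  proof -
    have "closed_segment (Complex x y1) (Complex x y2) = {z. Re z = x \<and> Im z \<in> closed_segment y1 y2}"
      using closed_segment_same_Re[of "Complex x y1" "Complex x y2"] by simp
    also have "closed_segment y1 y2 = {-M..M}"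
      using that(1) \<open>M > 0\<close> by (auto simp: closed_segment_eq_real_ivl doubleton_eq_iff)
    finally have seg: "closed_segment (Complex x y1) (Complex x y2) = {z. Re z = x \<and> Im z \<in> {-M..M}}" .
    have low: "\<epsilon> \<le> norm (g z)" "norm (deriv g z) \<le> B"
      if "z \<in> closed_segment (Complex x y1) (Complex x y2)" for z
      using that good B[of z] unfolding seg by (auto simp: complex_eq_iff) (metis atLeastAtMost_iff complex.collapse)
    have "continuous_on (closed_segment (Complex x y1) (Complex x y2)) f"
      unfolding f_def
    proof (intro continuous_on_divide)
      show "\<forall>z\<in>closed_segment (Complex x y1) (Complex x y2). g z \<noteq> 0"
        using low(1) \<open>\<epsilon> > 0\<close> by fastforce
    qed (auto intro!: holomorphic_on_imp_continuous_on holomorphic_g holomorphic_deriv[where S = UNIV, THEN holomorphic_on_subset])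
    then have int: "f contour_integrable_on linepath (Complex x y1) (Complex x y2)"
      by (rule contour_integrable_continuous_linepath)
    have "norm (contour_integral (linepath (Complex x y1) (Complex x y2)) f)
        \<le> B / \<epsilon> * norm (Complex x y2 - Complex x y1)"
    proof (rule contour_integral_bound_linepath[OF int])
      fix z assume "z \<in> closed_segment (Complex x y1) (Complex x y2)"
      from low[OF this] show "norm (f z) \<le> B / \<epsilon>"
        unfolding f_def norm_divide using \<open>\<epsilon> > 0\<close> B0 by (intro frac_le) auto
    qed (use B0 \<open>\<epsilon> > 0\<close> in auto)
    also have "norm (Complex x y2 - Complex x y1) = 2 * M"
      using that(1) \<open>M > 0\<close> by (auto simp: cmod_def doubleton_eq_iff)
    finally show ?thesis using int by blast
  qed
  define K where "K = (4 + 2 * (B / \<epsilon> * (2 * M))) / (2 * pi)"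
  have "\<bar>real_of_int (\<Sum>z | g z = 0 \<and> x1 < Re z \<and> Re z < x2. zorder g z)
        - (\<mu> hi - \<mu> lo) / (2 * pi) * (x2 - x1)\<bar> \<le> K"
    if less: "x1 < x2" and good1: "\<forall>y\<in>{-M..M}. \<epsilon> \<le> norm (g (Complex x1 y))"
      and good2: "\<forall>y\<in>{-M..M}. \<epsilon> \<le> norm (g (Complex x2 y))" for x1 x2
  proof -
    define a b a2 a4 where "a = Complex x1 (-M)" and "b = Complex x2 M"
      and "a2 = Complex x2 (-M)" and "a4 = Complex x1 M"
    have top: "g z \<noteq> 0" if "Im z \<ge> M" for z
      using dom(1)[of z] that by force
    have bot: "g z \<noteq> 0" if "Im z \<le> - M" for z
      using dom(2)[of z] that by force
    have ver: "g z \<noteq> 0" if "Re z = x1 \<or> Re z = x2" "\<bar>Im z\<bar> \<le> M" for z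
      using that good1 good2 \<open>\<epsilon> > 0\<close>
      by (metis abs_le_iff atLeastAtMost_iff complex.collapse linorder_not_le minus_le_iff norm_zero)
    have zeros: "{z. z \<in> box a b \<and> g z = 0} = {z. g z = 0 \<and> x1 < Re z \<and> Re z < x2}"
      using top bot by (auto simp: in_box_complex_iff a_def b_def not_le[symmetric])
    have rect: "contour_integral (rectpath a b) f = 2 * pi * \<i> *
        of_int (\<Sum>z | z \<in> box a b \<and> g z = 0. zorder g z)"
      unfolding f_def
    proof (rule rectangle_argument_principle[OF holomorphic_g])
      fix z assume "z \<in> cbox a b - box a b"
      then show "g z \<noteq> 0"
        using top[of z] bot[of z] ver[of z]
        by (fastforce simp: a_def b_def in_cbox_complex_iff in_box_complex_iff abs_le_iff)
    qed (use less \<open>M > 0\<close> in \<open>auto simp: a_def b_def\<close>)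
    have seg: "closed_segment a a2 \<subseteq> {z. Im z < - (M - 1)}" "closed_segment b a4 \<subseteq> {z. Im z > M - 1}"
      by (auto simp: a_def a2_def b_def a4_def closed_segment_same_Im)
    obtain e1 where e1: "norm e1 \<le> 2"
        "(f has_contour_integral (\<i> * of_real (\<mu> hi) * (a2 - a) + e1)) (linepath a a2)"
      unfolding f_def
      using log_deriv_integral_dominated[OF holomorphic_g hi(2), of "{z. Im z < - (M - 1)}" "\<mu> hi" a a2]
        dom(2) seg(1)
      by blast
    obtain e3 where e3: "norm e3 \<le> 2"
        "(f has_contour_integral (\<i> * of_real (\<mu> lo) * (a4 - b) + e3)) (linepath b a4)"
      unfolding f_def
      using log_deriv_integral_dominated[OF holomorphic_g lo(2), of "{z. Im z > M - 1}" "\<mu> lo" b a4]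
        dom(1) seg(2)
      by blast
    define e2 e4 where "e2 = contour_integral (linepath a2 b) f"
      and "e4 = contour_integral (linepath a4 a) f"
    have e2: "f contour_integrable_on linepath a2 b" "norm e2 \<le> B / \<epsilon> * (2 * M)"
      using vertical[of "-M" M x2] good2 unfolding e2_def a2_def b_def by auto
    have e4: "f contour_integrable_on linepath a4 a" "norm e4 \<le> B / \<epsilon> * (2 * M)"
      using vertical[of M "-M" x1] good1 unfolding e4_def a4_def a_def by (auto simp: insert_commute)
    define n where "n = real_of_int (\<Sum>z | g z = 0 \<and> x1 < Re z \<and> Re z < x2. zorder g z)"
    have "(f has_contour_integral ((\<i> * of_real (\<mu> hi) * (a2 - a) + e1)
        + (e2 + ((\<i> * of_real (\<mu> lo) * (a4 - b) + e3) + e4)))) (rectpath a b)"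
      using e1(2) e3(2) has_contour_integral_integral[OF e2(1)] has_contour_integral_integral[OF e4(1)]
      unfolding rectpath_def Let_def e2_def e4_def
      by (intro has_contour_integral_join) (auto simp: a_def b_def a2_def a4_def intro!: valid_path_join)
    from contour_integral_unique[OF this] rect
    have "2 * pi * \<i> * of_real n = \<i> * of_real ((\<mu> hi - \<mu> lo) * (x2 - x1)) + (e1 + e2 + e3 + e4)"
      unfolding zeros n_def by (simp add: a_def b_def a2_def a4_def Complex_eq algebra_simps)
    then have "\<i> * of_real (2 * pi * n - (\<mu> hi - \<mu> lo) * (x2 - x1)) = e1 + e2 + e3 + e4"
      by (simp add: algebra_simps)
    then have "\<bar>2 * pi * n - (\<mu> hi - \<mu> lo) * (x2 - x1)\<bar> = norm (e1 + e2 + e3 + e4)"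
      by (metis norm_mult norm_ii mult_1 norm_of_real)
    also have "\<dots> \<le> 4 + 2 * (B / \<epsilon> * (2 * M))"
      using norm_triangle_ineq[of "e1 + e2 + e3" e4] norm_triangle_ineq[of "e1 + e2" e3]
        norm_triangle_ineq[of e1 e2] e1(1) e2(2) e3(1) e4(2) by linarith
    also have "\<dots> = 2 * pi * K" by (simp add: K_def)
    finally have "\<bar>2 * pi * n - (\<mu> hi - \<mu> lo) * (x2 - x1)\<bar> \<le> 2 * pi * K" .
    moreover have "2 * pi * n - (\<mu> hi - \<mu> lo) * (x2 - x1)
        = 2 * pi * (n - (\<mu> hi - \<mu> lo) / (2 * pi) * (x2 - x1))"
      by (simp add: field_simps)
    ultimately show ?thesis by (simp add: abs_mult n_def)
  qed
  then show ?thesis by blast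
qed

text \<open>Lines at arbitrary abscissae \<open>x1\<close>, \<open>x2\<close> may meet zeros or pass close to them. Since zeros
  have positive order, the count is squeezed between those for good lines at distance at most \<open>1\<close>
  inside and outside. The inner lines are in the right order once \<open>x2 - x1 > 2\<close>.\<close>

theorem zero_count_linear:
  "\<exists>K. \<forall>x1 x2. x2 - x1 > 2 \<longrightarrow>
     \<bar>real_of_int (\<Sum>z | g z = 0 \<and> x1 < Re z \<and> Re z < x2. zorder g z)
        - (\<mu> hi - \<mu> lo) / (2 * pi) * (x2 - x1)\<bar> \<le> K"
proof -
  define n where "n x1 x2 = real_of_int (\<Sum>z | g z = 0 \<and> x1 < Re z \<and> Re z < x2. zorder g z)" for x1 x2
  define d where "d = (\<mu> hi - \<mu> lo) / (2 * pi)"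
  have "d \<ge> 0" using lo_less_hi by (simp add: d_def)
  obtain M where M: "M > 0"
    "\<And>z. Im z > M \<Longrightarrow> norm (g z / (c lo * exp (\<i> * of_real (\<mu> lo) * z)) - 1) < 1/2"
    "\<And>z. Im z < - M \<Longrightarrow> norm (g z / (c hi * exp (\<i> * of_real (\<mu> hi) * z)) - 1) < 1/2"
    using both_dominate by blast
  define good where "good \<epsilon> x \<longleftrightarrow> (\<forall>y\<in>{-(M+1)..M+1}. \<epsilon> \<le> norm (g (Complex x y)))" for \<epsilon> x
  obtain \<epsilon> where \<epsilon>: "\<epsilon> > 0" "\<And>a. \<exists>x\<in>{a..a+1}. good \<epsilon> x"
    using good_vertical_lines[of "M + 1"] unfolding good_def by blast
  obtain K where K: "\<And>x1 x2. x1 < x2 \<Longrightarrow> good \<epsilon> x1 \<Longrightarrow> good \<epsilon> x2 \<Longrightarrow>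
      \<bar>n x1 x2 - d * (x2 - x1)\<bar> \<le> K"
    using zero_count_between_good_lines[of "M + 1" \<epsilon>] M \<epsilon>(1) unfolding good_def n_def d_def by auto
  have mono: "n x1 x2 \<le> n y1 y2" if "y1 \<le> x1" "x2 \<le> y2" for x1 x2 y1 y2
    unfolding n_def of_int_le_iff
    using that zorder_pos_at_zero by (intro sum_mono2 finite_zeros_between) (force intro: less_imp_le)+
  have "\<bar>n x1 x2 - d * (x2 - x1)\<bar> \<le> K + 2 * d" if "x2 - x1 > 2" for x1 x2
  proof -
    obtain o1 where o1: "o1 \<in> {x1-1..x1}" "good \<epsilon> o1" using \<epsilon>(2)[of "x1 - 1"] by auto
    obtain o2 where o2: "o2 \<in> {x2..x2+1}" "good \<epsilon> o2" using \<epsilon>(2)[of x2] by auto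
    obtain i1 where i1: "i1 \<in> {x1..x1+1}" "good \<epsilon> i1" using \<epsilon>(2)[of x1] by auto
    obtain i2 where i2: "i2 \<in> {x2-1..x2}" "good \<epsilon> i2" using \<epsilon>(2)[of "x2 - 1"] by auto
    have "n x1 x2 \<le> n o1 o2" "n i1 i2 \<le> n x1 x2"
      using o1 o2 i1 i2 by (auto intro!: mono)
    moreover have "\<bar>n o1 o2 - d * (o2 - o1)\<bar> \<le> K" "\<bar>n i1 i2 - d * (i2 - i1)\<bar> \<le> K"
      using o1 o2 i1 i2 that by (auto intro!: K)
    moreover have "d * (o2 - o1) \<le> d * (x2 - x1 + 2)" "d * (x2 - x1 - 2) \<le> d * (i2 - i1)"
      using o1 o2 i1 i2 \<open>d \<ge> 0\<close> by (auto intro!: mult_left_mono)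
    ultimately show ?thesis by (simp add: algebra_simps)
  qed
  then show ?thesis unfolding n_def d_def by blast
qed

theorem zero_density:
  assumes "zeros_in_strip g C1 C2"
  shows "((\<lambda>(x1, x2). of_int (zero_count g C1 C2 x1 x2) / (x2 - x1)) \<longlongrightarrow>
            (\<mu> hi - \<mu> lo) / (2 * pi))
           (filtercomap (\<lambda>(x1, x2). x2 - x1) at_top)"
proof -
  have cnt: "zero_count g C1 C2 x1 x2 = (\<Sum>z | g z = 0 \<and> x1 < Re z \<and> Re z < x2. zorder g z)" for x1 x2
    unfolding zero_count_def using assms by (intro sum.cong) (auto simp: zeros_in_strip_def)
  define d where "d = (\<mu> hi - \<mu> lo) / (2 * pi)"
  obtain K where K: "\<And>x1 x2. x2 - x1 > 2 \<Longrightarrow> \<bar>of_int (zero_count g C1 C2 x1 x2) - d * (x2 - x1)\<bar> \<le> K"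
    using zero_count_linear unfolding cnt d_def by blast
  let ?F = "filtercomap (\<lambda>(x1, x2). x2 - x1) (at_top :: real filter)"
  have lim: "filterlim (\<lambda>(x1, x2). x2 - x1) at_top ?F"
    by (rule filterlim_filtercomap)
  have "((\<lambda>p. K / (case p of (x1, x2) \<Rightarrow> x2 - x1)) \<longlongrightarrow> 0) ?F"
    by (rule tendsto_divide_0[OF tendsto_const filterlim_at_top_imp_at_infinity[OF lim]])
  moreover have "eventually (\<lambda>p. norm ((case p of (x1, x2) \<Rightarrow> of_int (zero_count g C1 C2 x1 x2) / (x2 - x1)) - d)
      \<le> K / (case p of (x1, x2) \<Rightarrow> x2 - x1)) ?F"
    using filterlim_at_top_dense[THEN iffD1, OF lim, rule_format, of 2]
  proof eventually_elim
    case (elim p)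
    obtain x1 x2 where p: "p = (x1, x2)" by (cases p)
    have L: "x2 - x1 > 2" using elim by (simp add: p)
    have "of_int (zero_count g C1 C2 x1 x2) / (x2 - x1) - d
        = (of_int (zero_count g C1 C2 x1 x2) - d * (x2 - x1)) / (x2 - x1)"
      using L by (simp add: field_simps)
    then show ?case
      using K[OF L] L by (simp add: p abs_divide divide_right_mono)
  qed
  ultimately have "((\<lambda>p. (case p of (x1, x2) \<Rightarrow> of_int (zero_count g C1 C2 x1 x2) / (x2 - x1)) - d) \<longlongrightarrow> 0) ?F"
    by (rule Lim_null_comparison[rotated])
  then show ?thesis
    unfolding d_def by (rule LIM_zero_cancel)
qed

theorem infinite_zeros: "infinite {z. g z = 0}"
proof
  assume fin: "finite {z. g z = 0}"
  define d where "d = (\<mu> hi - \<mu> lo) / (2 * pi)"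
  have "d > 0" using lo_less_hi by (simp add: d_def)
  obtain K where K: "\<And>x1 x2. x2 - x1 > 2 \<Longrightarrow>
      \<bar>real_of_int (\<Sum>z | g z = 0 \<and> x1 < Re z \<and> Re z < x2. zorder g z) - d * (x2 - x1)\<bar> \<le> K"
    using zero_count_linear unfolding d_def by blast
  define T where "T = real_of_int (\<Sum>z | g z = 0. zorder g z)"
  define x where "x = max 3 ((K + T + 1) / d)"
  have "real_of_int (\<Sum>z | g z = 0 \<and> 0 < Re z \<and> Re z < x. zorder g z) \<le> T"
    unfolding T_def of_int_le_iff
    using zorder_pos_at_zero by (intro sum_mono2 fin) (force intro: less_imp_le)+
  moreover have "d * x \<ge> K + T + 1"
    using \<open>d > 0\<close> by (simp add: x_def pos_divide_le_eq[symmetric] mult.commute[of d])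
  moreover have "x - 0 > 2" by (simp add: x_def)
  note K[OF this]
  ultimately show False by (simp del: of_int_sum)
qed

end

section \<open>The resonance function as a sum over sign paths\<close>

text \<open>In contrast to \<open>sign_vectors\<close> the number of free signs is arbitrary here, odd or even, which
  permits induction one sign at a time.\<close>

definition sign_paths :: "nat \<Rightarrow> (nat \<Rightarrow> int) set" where
  "sign_paths n = {\<alpha>. \<forall>j. (j \<in> {1..n} \<longrightarrow> \<alpha> j \<in> {-1, 1}) \<and> (j \<notin> {1..n} \<longrightarrow> \<alpha> j = -1)}"

text \<open>The factor that one interface contributes to a summand of the resonance function.\<close>

definition jump :: "complex \<Rightarrow> nat \<Rightarrow> int \<Rightarrow> int \<Rightarrow> complex" where
  "jump \<rho> j a b = (if a \<noteq> b then (-1) ^ j * \<rho> else 1)"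

text \<open>The partial sum over the signs in the first \<open>n\<close> layers, with the sign behind them prescribed: for
  odd \<open>n = 2 N - 1\<close> and \<open>b = -1\<close> it is the resonance function.\<close>

definition layer_sum :: "complex \<Rightarrow> (nat \<Rightarrow> real) \<Rightarrow> complex \<Rightarrow> nat \<Rightarrow> int \<Rightarrow> complex" where
  "layer_sum \<rho> t k n b =
     (\<Sum>\<alpha>\<in>sign_paths n.
        (\<Prod>j=1..n. jump \<rho> j (\<alpha> (j - 1)) (\<alpha> j) * exp (\<i> * of_real (of_int (\<alpha> j) * t j) * k)) *
        jump \<rho> (Suc n) (\<alpha> n) b)"

lemma sign_vectors_eq: "sign_vectors N = sign_paths (2 * N - 1)"
  by (simp add: sign_vectors_def sign_paths_def)

lemma sign_paths_0: "sign_paths 0 = {\<lambda>_. -1}"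
  by (auto simp: sign_paths_def fun_eq_iff)

lemma sign_paths_Suc:
  "bij_betw (\<lambda>(\<alpha>, c). \<alpha>(Suc n := c)) (sign_paths n \<times> {-1, 1}) (sign_paths (Suc n))"
proof (rule bij_betw_byWitness[where f' = "\<lambda>\<beta>. (\<beta>(Suc n := -1), \<beta> (Suc n))"])
  show "\<forall>p\<in>sign_paths n \<times> {-1, 1}.
      (\<lambda>\<beta>. (\<beta>(Suc n := -1), \<beta> (Suc n))) ((\<lambda>(\<alpha>, c). \<alpha>(Suc n := c)) p) = p"
    by (auto simp: sign_paths_def fun_eq_iff)
qed (auto simp: sign_paths_def le_Suc_eq)

lemma layer_sum_0: "layer_sum \<rho> t k 0 b = jump \<rho> 1 (-1) b"
  by (simp add: layer_sum_def sign_paths_0)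

text \<open>One step of the transfer matrix: split according to the sign in the last layer.\<close>

lemma layer_sum_Suc:
  "layer_sum \<rho> t k (Suc n) b =
     layer_sum \<rho> t k n (-1) * exp (- (\<i> * of_real (t (Suc n)) * k)) * jump \<rho> (Suc (Suc n)) (-1) b +
     layer_sum \<rho> t k n 1 * exp (\<i> * of_real (t (Suc n)) * k) * jump \<rho> (Suc (Suc n)) 1 b"
proof -
  define W where "W m \<alpha> = (\<Prod>j=1..m. jump \<rho> j (\<alpha> (j - 1)) (\<alpha> j) *
      exp (\<i> * of_real (of_int (\<alpha> j) * t j) * k))" for m \<alpha>
  define P where "P c = exp (\<i> * of_real (of_int c * t (Suc n)) * k) * jump \<rho> (Suc (Suc n)) c b" for c
  have step: "W (Suc n) (\<alpha>(Suc n := c)) = W n \<alpha> * jump \<rho> (Suc n) (\<alpha> n) c *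
      exp (\<i> * of_real (of_int c * t (Suc n)) * k)" for \<alpha> c
  proof -
    have "(\<Prod>j=1..n. jump \<rho> j ((\<alpha>(Suc n := c)) (j - 1)) ((\<alpha>(Suc n := c)) j) *
        exp (\<i> * of_real (of_int ((\<alpha>(Suc n := c)) j) * t j) * k)) = W n \<alpha>"
      unfolding W_def by (intro prod.cong) auto
    then show ?thesis by (simp add: W_def mult.assoc)
  qed
  have "layer_sum \<rho> t k (Suc n) b =
      (\<Sum>\<alpha>\<in>sign_paths (Suc n). W (Suc n) \<alpha> * jump \<rho> (Suc (Suc n)) (\<alpha> (Suc n)) b)"
    by (simp add: layer_sum_def W_def)
  also have "\<dots> = (\<Sum>(\<alpha>, c)\<in>sign_paths n \<times> {-1, 1}.
      W (Suc n) (\<alpha>(Suc n := c)) * jump \<rho> (Suc (Suc n)) c b)"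
    by (subst sum.reindex_bij_betw[OF sign_paths_Suc, symmetric]) (auto intro!: sum.cong)
  also have "\<dots> = (\<Sum>\<alpha>\<in>sign_paths n. \<Sum>c\<in>{-1, 1}. W n \<alpha> * jump \<rho> (Suc n) (\<alpha> n) c * P c)"
    unfolding sum.cartesian_product[symmetric] step P_def by (simp add: mult.assoc)
  also have "\<dots> = (\<Sum>c\<in>{-1, 1}. \<Sum>\<alpha>\<in>sign_paths n. W n \<alpha> * jump \<rho> (Suc n) (\<alpha> n) c * P c)"
    by (rule sum.swap)
  also have "\<dots> = (\<Sum>c\<in>{-1, 1}. layer_sum \<rho> t k n c * P c)"
    by (simp only: layer_sum_def W_def sum_distrib_right)
  finally show ?thesis by (simp add: P_def mult.assoc)
qed

lemma resonance_fun_eq_layer_sum: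
  assumes "N \<ge> 1"
  shows "resonance_fun N t \<sigma> k = layer_sum ((1 - \<sigma>) / (1 + \<sigma>)) t k (2 * N - 1) (-1)"
  unfolding resonance_fun_def layer_sum_def sign_vectors_eq
proof (rule sum.cong[OF refl])
  define \<rho> where "\<rho> = (1 - \<sigma>) / (1 + \<sigma>)"
  define n where "n = 2 * N - 1"
  have n: "2 * N = Suc n" using assms by (simp add: n_def)
  fix \<alpha> assume "\<alpha> \<in> sign_paths (2 * N - 1)"
  then have last: "\<alpha> (Suc n) = -1" by (simp add: sign_paths_def n_def)
  have "(-1) ^ (\<Sum>j=1..Suc n. j * sign_change \<alpha> j) * \<rho> ^ (\<Sum>j=1..Suc n. sign_change \<alpha> j)
      = (\<Prod>j=1..Suc n. jump \<rho> j (\<alpha> (j - 1)) (\<alpha> j))"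
    unfolding power_sum prod.distrib[symmetric]
    by (intro prod.cong) (auto simp: jump_def sign_change_def)
  moreover have "exp (\<i> * of_real (\<Sum>j=1..n. of_int (\<alpha> j) * t j) * k)
      = (\<Prod>j=1..n. exp (\<i> * of_real (of_int (\<alpha> j) * t j) * k))"
    by (simp add: exp_sum[symmetric] sum_distrib_left sum_distrib_right)
  ultimately show "(-1) ^ (\<Sum>j=1..2 * N. j * sign_change \<alpha> j) *
        ((1 - \<sigma>) / (1 + \<sigma>)) ^ (\<Sum>j=1..2 * N. sign_change \<alpha> j) *
        exp (\<i> * of_real (\<Sum>j=1..2 * N - 1. of_int (\<alpha> j) * t j) * k) =
      (\<Prod>j=1..2 * N - 1. jump ((1 - \<sigma>) / (1 + \<sigma>)) j (\<alpha> (j - 1)) (\<alpha> j) *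
         exp (\<i> * of_real (of_int (\<alpha> j) * t j) * k)) *
      jump ((1 - \<sigma>) / (1 + \<sigma>)) (Suc (2 * N - 1)) (\<alpha> (2 * N - 1)) (-1)"
    unfolding n_def[symmetric] \<rho>_def[symmetric] unfolding n
    by (simp add: prod.distrib last)
qed

text \<open>The difference of the squared norms is \<open>(1 - p\<^sup>2) (\<bar>A\<bar>\<^sup>2 - \<bar>B\<bar>\<^sup>2)\<close>.\<close>

lemma norm_reflection_less:
  fixes A B :: complex and p :: real
  assumes "norm B < norm A" "\<bar>p\<bar> < 1"
  shows "norm (B + of_real p * A) < norm (A + of_real p * B)"
proof -
  have "(norm (A + of_real p * B))\<^sup>2 - (norm (B + of_real p * A))\<^sup>2
      = (1 - p\<^sup>2) * ((norm A)\<^sup>2 - (norm B)\<^sup>2)"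
    unfolding cmod_power2 by (simp add: power2_eq_square algebra_simps)
  moreover have "p\<^sup>2 < 1" using assms(2) by (simp add: abs_square_less_1)
  moreover have "(norm B)\<^sup>2 < (norm A)\<^sup>2" using assms(1) by (intro power_strict_mono) auto
  ultimately have "(norm (A + of_real p * B))\<^sup>2 - (norm (B + of_real p * A))\<^sup>2 > 0"
    by simp
  then have "(norm (B + of_real p * A))\<^sup>2 < (norm (A + of_real p * B))\<^sup>2" by simp
  then show ?thesis by (rule power2_less_imp_less) simp
qed

text \<open>Each step multiplies the larger entry by \<open>exp (- \<i> t k)\<close>, of modulus at least \<open>1\<close>, the smaller one by
  \<open>exp (\<i> t k)\<close>, of modulus at most \<open>1\<close>, and then mixes them with a real coefficient of modulus less
  than \<open>1\<close>. None of these operations destroys the strict order of the moduli.\<close>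

lemma layer_sum_upper_half_plane:
  assumes "\<bar>p\<bar> < 1" "Im k \<ge> 0" "\<And>j. 1 \<le> j \<Longrightarrow> j \<le> n \<Longrightarrow> t j \<ge> 0"
  shows "norm (layer_sum (of_real p) t k n 1) < norm (layer_sum (of_real p) t k n (-1))"
  using assms(3)
proof (induction n)
  case 0
  then show ?case using assms(1) by (simp add: layer_sum_0 jump_def)
next
  case (Suc n)
  define A where "A = layer_sum (of_real p) t k n (-1) * exp (- (\<i> * of_real (t (Suc n)) * k))"
  define B where "B = layer_sum (of_real p) t k n 1 * exp (\<i> * of_real (t (Suc n)) * k)"
  have t: "0 \<le> t (Suc n) * Im k" using Suc.prems[of "Suc n"] assms(2) by simp
  have IH: "norm (layer_sum (of_real p) t k n 1) < norm (layer_sum (of_real p) t k n (-1))"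
    using Suc by simp
  have "norm B \<le> norm (layer_sum (of_real p) t k n 1) * 1"
    unfolding B_def norm_mult using t by (intro mult_left_mono) auto
  also have "\<dots> < norm (layer_sum (of_real p) t k n (-1)) * 1" using IH by simp
  also have "\<dots> \<le> norm A"
    unfolding A_def norm_mult using t by (intro mult_left_mono) auto
  finally have "norm B < norm A" .
  then have "norm (B + of_real ((-1) ^ n * p) * A) < norm (A + of_real ((-1) ^ n * p) * B)"
    using assms(1) by (intro norm_reflection_less) (auto simp: abs_mult)
  moreover have "layer_sum (of_real p) t k (Suc n) 1 = B + of_real ((-1) ^ n * p) * A"
    "layer_sum (of_real p) t k (Suc n) (-1) = A + of_real ((-1) ^ n * p) * B"
    by (simp_all add: layer_sum_Suc jump_def A_def B_def algebra_simps)
  ultimately show ?case by simp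
qed

section \<open>Amplitudes of plane waves in the layers\<close>

text \<open>Layer \<open>0\<close> is the left half line. Its waves are anchored at the first interface, so no
  phase is accumulated on the way to it.\<close>

definition phase :: "(nat \<Rightarrow> real) \<Rightarrow> complex \<Rightarrow> nat \<Rightarrow> complex" where
  "phase t k j = (if j = 0 then 1 else exp (\<i> * of_real (t j) * k))"

text \<open>\<open>a j\<close> and \<open>b j\<close> are the amplitudes of the left-going and the right-going wave in layer \<open>j\<close>,
  measured at its left end; \<open>a'\<close> and \<open>b'\<close> are their values at its right end. The equations
  are the continuity of the wave and the jump of its derivative at the interface to layer \<open>j + 1\<close>. The
  factor \<open>\<sigma>\<close> stands on the side of the even layer, outside the resonators. It is not
  inverted, so that \<open>\<sigma> = 0\<close> is covered.\<close>

definition amplitude_step ::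
  "(nat \<Rightarrow> real) \<Rightarrow> complex \<Rightarrow> complex \<Rightarrow> (nat \<Rightarrow> complex) \<Rightarrow> (nat \<Rightarrow> complex) \<Rightarrow> nat \<Rightarrow> bool" where
  "amplitude_step t \<sigma> k a b j \<longleftrightarrow>
     (let a' = a j / phase t k j; b' = b j * phase t k j in
        a (Suc j) + b (Suc j) = a' + b' \<and>
        (if even j then b (Suc j) - a (Suc j) = \<sigma> * (b' - a')
         else \<sigma> * (b (Suc j) - a (Suc j)) = b' - a'))"

text \<open>Radiation conditions: no wave comes in from the left (\<open>b 0 = 0\<close>) or from the right
  (\<open>a (2 * N) = 0\<close>).\<close>

definition resonant_amplitudes ::
  "nat \<Rightarrow> (nat \<Rightarrow> real) \<Rightarrow> complex \<Rightarrow> complex \<Rightarrow> (nat \<Rightarrow> complex) \<Rightarrow> (nat \<Rightarrow> complex) \<Rightarrow> bool" where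
  "resonant_amplitudes N t \<sigma> k a b \<longleftrightarrow>
     b 0 = 0 \<and> a (2 * N) = 0 \<and> (\<forall>j<2 * N. amplitude_step t \<sigma> k a b j) \<and>
     (\<exists>j\<le>2 * N. a j \<noteq> 0 \<or> b j \<noteq> 0)"

definition transmission :: "complex \<Rightarrow> nat \<Rightarrow> complex" where
  "transmission \<sigma> j = (if even j then (1 + \<sigma>) / 2 else (1 + \<sigma>) / (2 * \<sigma>))"

lemma transmission_nonzero: "\<sigma> \<noteq> 0 \<Longrightarrow> \<sigma> \<noteq> -1 \<Longrightarrow> transmission \<sigma> j \<noteq> 0"
  by (auto simp: transmission_def add_eq_0_iff)

lemma sum_diff_solve:
  fixes A B x y c :: complex
  shows "A + B = x + y \<and> B - A = c * (y - x) \<longleftrightarrow>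
    A = ((1 + c) * x + (1 - c) * y) / 2 \<and> B = ((1 + c) * y + (1 - c) * x) / 2"
proof
  assume *: "A + B = x + y \<and> B - A = c * (y - x)"
  then have "2 * A = (x + y) - c * (y - x)" "2 * B = (x + y) + c * (y - x)"
    by (simp_all flip: *[THEN conjunct1] *[THEN conjunct2])
  then show "A = ((1 + c) * x + (1 - c) * y) / 2 \<and> B = ((1 + c) * y + (1 - c) * x) / 2"
    by (simp add: field_simps)
next
  assume "A = ((1 + c) * x + (1 - c) * y) / 2 \<and> B = ((1 + c) * y + (1 - c) * x) / 2"
  then have A: "A = ((1 + c) * x + (1 - c) * y) / 2" and B: "B = ((1 + c) * y + (1 - c) * x) / 2"
    by auto
  show "A + B = x + y \<and> B - A = c * (y - x)"
    unfolding A B by (simp add: field_simps)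
qed

lemma amplitude_step_iff:
  assumes "\<sigma> \<noteq> 0" "\<sigma> \<noteq> -1"
  defines "\<rho> \<equiv> (1 - \<sigma>) / (1 + \<sigma>)"
  shows "amplitude_step t \<sigma> k a b j \<longleftrightarrow>
    a (Suc j) = transmission \<sigma> j * (a j / phase t k j + (-1) ^ j * \<rho> * (b j * phase t k j)) \<and>
    b (Suc j) = transmission \<sigma> j * (b j * phase t k j + (-1) ^ j * \<rho> * (a j / phase t k j))"
proof -
  define x y where "x = a j / phase t k j" and "y = b j * phase t k j"
  have s: "1 + \<sigma> \<noteq> 0" using assms(2) by (simp add: add_eq_0_iff)
  then have \<rho>: "1 - \<sigma> = (1 + \<sigma>) * \<rho>" by (simp add: \<rho>_def)
  have inv: "1 + 1 / \<sigma> = (1 + \<sigma>) / \<sigma>" "1 - 1 / \<sigma> = - (1 - \<sigma>) / \<sigma>"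
    using assms(1) by (simp_all add: field_simps)
  show ?thesis
  proof (cases "even j")
    case True
    then have "amplitude_step t \<sigma> k a b j \<longleftrightarrow>
        a (Suc j) + b (Suc j) = x + y \<and> b (Suc j) - a (Suc j) = \<sigma> * (y - x)"
      by (simp add: amplitude_step_def Let_def x_def y_def)
    also have "\<dots> \<longleftrightarrow> a (Suc j) = ((1 + \<sigma>) * x + (1 - \<sigma>) * y) / 2 \<and>
        b (Suc j) = ((1 + \<sigma>) * y + (1 - \<sigma>) * x) / 2"
      by (rule sum_diff_solve)
    also have "((1 + \<sigma>) * x + (1 - \<sigma>) * y) / 2 = transmission \<sigma> j * (x + (-1) ^ j * \<rho> * y)"
      unfolding \<rho> using True by (simp add: transmission_def algebra_simps)
    also have "((1 + \<sigma>) * y + (1 - \<sigma>) * x) / 2 = transmission \<sigma> j * (y + (-1) ^ j * \<rho> * x)"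
      unfolding \<rho> using True by (simp add: transmission_def algebra_simps)
    finally show ?thesis by (simp add: x_def y_def)
  next
    case False
    then have "amplitude_step t \<sigma> k a b j \<longleftrightarrow>
        a (Suc j) + b (Suc j) = x + y \<and> b (Suc j) - a (Suc j) = (1 / \<sigma>) * (y - x)"
      using assms(1) by (auto simp: amplitude_step_def Let_def x_def y_def field_simps)
    also have "\<dots> \<longleftrightarrow> a (Suc j) = ((1 + 1 / \<sigma>) * x + (1 - 1 / \<sigma>) * y) / 2 \<and>
        b (Suc j) = ((1 + 1 / \<sigma>) * y + (1 - 1 / \<sigma>) * x) / 2"
      by (rule sum_diff_solve)
    also have "((1 + 1 / \<sigma>) * x + (1 - 1 / \<sigma>) * y) / 2 = transmission \<sigma> j * (x + (-1) ^ j * \<rho> * y)"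
      unfolding inv \<rho> using False assms(1) by (simp add: transmission_def field_simps)
    also have "((1 + 1 / \<sigma>) * y + (1 - 1 / \<sigma>) * x) / 2 = transmission \<sigma> j * (y + (-1) ^ j * \<rho> * x)"
      unfolding inv \<rho> using False assms(1) by (simp add: transmission_def field_simps)
    finally show ?thesis by (simp add: x_def y_def)
  qed
qed

text \<open>The amplitude equations and the recursion for the layer sums agree up to the factors
  \<open>transmission \<sigma> i\<close> and the sign of \<open>b\<close>: the sign \<open>(-1) ^ j\<close> in \<open>jump\<close> is opposite to the
  one of the reflection coefficient at interface \<open>j\<close>, and replacing \<open>b\<close> by \<open>- b\<close> exchanges the two.\<close>

lemma amplitudes_eq_layer_sums:
  assumes "\<sigma> \<noteq> 0" "\<sigma> \<noteq> -1" "b 0 = 0"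
  defines "\<rho> \<equiv> (1 - \<sigma>) / (1 + \<sigma>)"
  shows "(\<forall>j<n. amplitude_step t \<sigma> k a b j) \<longleftrightarrow>
    (\<forall>j<n. a (Suc j) = (\<Prod>i\<le>j. transmission \<sigma> i) * layer_sum \<rho> t k j (-1) * a 0 \<and>
           b (Suc j) = - (\<Prod>i\<le>j. transmission \<sigma> i) * layer_sum \<rho> t k j 1 * a 0)"
proof (induction n)
  case (Suc n)
  let ?P = "\<lambda>j. a (Suc j) = (\<Prod>i\<le>j. transmission \<sigma> i) * layer_sum \<rho> t k j (-1) * a 0 \<and>
           b (Suc j) = - (\<Prod>i\<le>j. transmission \<sigma> i) * layer_sum \<rho> t k j 1 * a 0"
  have "amplitude_step t \<sigma> k a b n \<longleftrightarrow> ?P n" if IH: "\<forall>j<n. ?P j"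
  proof (cases n)
    case 0
    then show ?thesis
      unfolding amplitude_step_iff[OF assms(1,2)] \<rho>_def[symmetric]
      by (simp add: 0 layer_sum_0 jump_def phase_def assms(3) mult.assoc)
  next
    case (Suc m)
    then have "?P m" using IH by simp
    then show ?thesis
      unfolding amplitude_step_iff[OF assms(1,2)] \<rho>_def[symmetric]
      by (simp add: Suc layer_sum_Suc jump_def phase_def exp_minus divide_inverse algebra_simps)
  qed
  then show ?case using Suc.IH by (auto simp: less_Suc_eq)
qed simp

theorem resonant_amplitudes_iff:
  assumes "\<sigma> \<noteq> 0" "\<sigma> \<noteq> -1" "N \<ge> 1"
  shows "(\<exists>a b. resonant_amplitudes N t \<sigma> k a b) \<longleftrightarrow> resonance_fun N t \<sigma> k = 0"
proof -
  define \<rho> where "\<rho> = (1 - \<sigma>) / (1 + \<sigma>)"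
  define n where "n = 2 * N - 1"
  have n: "2 * N = Suc n" using assms by (simp add: n_def)
  define T where "T j = (\<Prod>i\<le>j. transmission \<sigma> i)" for j
  have T: "T j \<noteq> 0" for j using transmission_nonzero[OF assms(1,2)] by (simp add: T_def)
  have f: "resonance_fun N t \<sigma> k = layer_sum \<rho> t k n (-1)"
    unfolding resonance_fun_eq_layer_sum[OF assms(3)] \<rho>_def n_def ..
  show ?thesis
  proof
    assume "\<exists>a b. resonant_amplitudes N t \<sigma> k a b"
    then obtain a b where ab: "resonant_amplitudes N t \<sigma> k a b" by blast
    then have P: "\<And>j. j < Suc n \<Longrightarrow> a (Suc j) = T j * layer_sum \<rho> t k j (-1) * a 0"
        "\<And>j. j < Suc n \<Longrightarrow> b (Suc j) = - T j * layer_sum \<rho> t k j 1 * a 0"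
        and b0: "b 0 = 0" and aN: "a (Suc n) = 0"
      using amplitudes_eq_layer_sums[OF assms(1,2), of b "Suc n" t k a]
      by (auto simp: resonant_amplitudes_def n T_def \<rho>_def)
    obtain j where j: "j \<le> Suc n" "a j \<noteq> 0 \<or> b j \<noteq> 0"
      using ab unfolding resonant_amplitudes_def n by blast
    have "a 0 \<noteq> 0"
      using j P[of "j - 1"] b0 by (cases j) auto
    then show "resonance_fun N t \<sigma> k = 0"
      using P(1)[of n] aN T[of n] f by simp
  next
    assume 0: "resonance_fun N t \<sigma> k = 0"
    define a where "a j = (case j of 0 \<Rightarrow> 1 | Suc i \<Rightarrow> T i * layer_sum \<rho> t k i (-1))" for j
    define b where "b j = (case j of 0 \<Rightarrow> 0 | Suc i \<Rightarrow> - T i * layer_sum \<rho> t k i 1)" for j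
    have "\<forall>j<Suc n. amplitude_step t \<sigma> k a b j"
      by (subst amplitudes_eq_layer_sums[OF assms(1,2)]) (auto simp: a_def b_def T_def \<rho>_def)
    moreover have "a (Suc n) = 0" using 0 f by (simp add: a_def)
    ultimately have "resonant_amplitudes N t \<sigma> k a b"
      unfolding resonant_amplitudes_def n by (auto simp: b_def a_def intro!: exI[of _ 0])
    then show "\<exists>a b. resonant_amplitudes N t \<sigma> k a b" by blast
  qed
qed

text \<open>With \<open>\<sigma> = 0\<close> a resonator carries a Neumann problem and a gap a Dirichlet problem with the boundary
  values of its neighbours. If no sine vanishes, the resonators have only the zero solution, then the
  gaps as well.\<close>

lemma resonant_amplitudes_decoupled_imp:
  assumes ab: "resonant_amplitudes N t 0 k a b"
  shows "\<exists>j\<in>{1..2 * N - 1}. sin (of_real (t j) * k) = 0"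
proof (rule ccontr)
  assume "\<not> ?thesis"
  then have nz: "sin (of_real (t j) * k) \<noteq> 0" if "j \<in> {1..2 * N - 1}" for j using that by blast
  have step: "amplitude_step t 0 k a b j" if "j < 2 * N" for j
    using ab that by (simp add: resonant_amplitudes_def)
  have ends: "b 0 = 0" "a (2 * N) = 0" using ab by (auto simp: resonant_amplitudes_def)
  have sin_eq: "exp (\<i> * of_real (t j) * k) - 1 / exp (\<i> * of_real (t j) * k) \<noteq> 0" if "j \<in> {1..2 * N - 1}" for j
    using nz[OF that] by (simp add: sin_exp_eq exp_minus field_simps)
  have odd0: "a j = 0 \<and> b j = 0" if "odd j" "j \<le> 2 * N" for j
  proof -
    have "j \<noteq> 2 * N" using that by auto
    with that have j: "j < 2 * N" "j \<in> {1..2 * N - 1}" "j > 0" by (auto elim: oddE)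
    have i: "j = Suc (j - 1)" "even (j - 1)" using \<open>odd j\<close> \<open>j > 0\<close> by auto
    have "a j = b j" using step[of "j - 1"] i j by (simp add: amplitude_step_def Let_def)
    moreover have "b j * phase t k j = a j / phase t k j"
      using step[of j] that j by (simp add: amplitude_step_def Let_def)
    ultimately have "a j * (exp (\<i> * of_real (t j) * k) - 1 / exp (\<i> * of_real (t j) * k)) = 0"
      using j(3) by (simp add: phase_def algebra_simps)
    then show ?thesis using sin_eq[OF j(2)] \<open>a j = b j\<close> by auto
  qed
  have even0: "a j = 0 \<and> b j = 0" if "even j" "j \<le> 2 * N" for j
  proof -
    have left: "a j + b j = 0" if "j > 0"
    proof -
      obtain i where i: "j = Suc i" using \<open>j > 0\<close> by (cases j) auto
      have "odd i" "i < 2 * N" using i \<open>even j\<close> \<open>j \<le> 2 * N\<close> by auto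
      then show ?thesis using step[of i] odd0[of i] i by (auto simp: amplitude_step_def Let_def)
    qed
    have right: "a j / phase t k j + b j * phase t k j = 0" if "j < 2 * N"
      using step[OF that] odd0[of "Suc j"] that \<open>even j\<close> by (auto simp: amplitude_step_def Let_def)
    consider "j = 0" | "j = 2 * N" | "0 < j" "j < 2 * N" using \<open>j \<le> 2 * N\<close> by linarith
    then show ?thesis
    proof cases
      case 1
      then show ?thesis using ends right by (cases "N = 0") (auto simp: phase_def)
    next
      case 2
      then show ?thesis using ends left by (cases "N = 0") auto
    next
      case 3
      then have "b j = - a j" using left by (simp add: add_eq_0_iff)
      then have "a j * (exp (\<i> * of_real (t j) * k) - 1 / exp (\<i> * of_real (t j) * k)) = 0"
        using right 3 by (simp add: phase_def algebra_simps)
      moreover have "j \<in> {1..2 * N - 1}" using 3 by auto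
      ultimately show ?thesis using sin_eq \<open>b j = - a j\<close> by auto
    qed
  qed
  show False using ab odd0 even0 by (auto simp: resonant_amplitudes_def)
qed

text \<open>If \<open>sin (t\<^sub>1 k) = 0\<close>, the first resonator has a Neumann mode. It extends to the two layers next
  to it by their Dirichlet problems, unless the right one is a gap whose Dirichlet problem is
  singular; in that case the gap itself carries a mode that vanishes outside it.\<close>

lemma resonant_amplitudes_decoupled:
  assumes "N \<ge> 1" and sin1: "sin (of_real (t 1) * k) = 0"
  shows "\<exists>a b. resonant_amplitudes N t 0 k a b"
proof -
  define e1 e2 where "e1 = exp (\<i> * of_real (t 1) * k)" and "e2 = exp (\<i> * of_real (t 2) * k)"
  have e0: "e1 \<noteq> 0" "e2 \<noteq> 0" by (auto simp: e1_def e2_def)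
  have e1: "e1 = 1 / e1"
    using sin1 by (simp add: sin_exp_eq exp_minus e1_def field_simps)
  have ph: "phase t k 0 = 1" "phase t k (Suc 0) = e1" "phase t k 2 = e2" "phase t k (Suc (Suc 0)) = e2"
    by (auto simp: phase_def e1_def e2_def numeral_2_eq_2)
  show ?thesis
  proof (cases "N = 1")
    case True
    define a where "a = (\<lambda>j::nat. 0::complex)(0 := 2, 1 := 1)"
    define b where "b = (\<lambda>j::nat. 0::complex)(1 := 1, 2 := 2 * e1)"
    have "amplitude_step t 0 k a b j" if "j < 2" for j
    proof -
      have "j = 0 \<or> j = 1" using that by auto
      then show ?thesis using e1 by (auto simp: amplitude_step_def a_def b_def ph numeral_2_eq_2)
    qed
    then have "resonant_amplitudes N t 0 k a b"
      by (auto simp: True resonant_amplitudes_def a_def b_def intro!: exI[of _ 0])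
    then show ?thesis by blast
  next
    case False
    then have N: "2 < 2 * N" using assms(1) by simp
    show ?thesis
    proof (cases "e2 = 1 / e2")
      case True
      define a where "a = (\<lambda>j::nat. 0::complex)(2 := 1)"
      define b where "b = (\<lambda>j::nat. 0::complex)(2 := - 1)"
      have "amplitude_step t 0 k a b j" for j
        using True by (cases "j = 1 \<or> j = 2") (auto simp: amplitude_step_def a_def b_def ph numeral_2_eq_2)
      then have "resonant_amplitudes N t 0 k a b"
        using N by (auto simp: resonant_amplitudes_def a_def b_def intro!: exI[of _ 2])
      then show ?thesis by blast
    next
      case False
      define d where "d = e2 - 1 / e2"
      have "d \<noteq> 0" using False by (simp add: d_def)
      define a where "a = (\<lambda>j::nat. 0::complex)(0 := 2, 1 := 1, 2 := 2 * e1 * e2 / d)"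
      define b where "b = (\<lambda>j::nat. 0::complex)(1 := 1, 2 := - 2 * e1 / e2 / d)"
      have "a 2 + b 2 = 2 * e1 * (e2 - 1 / e2) / d"
        using \<open>d \<noteq> 0\<close> by (simp add: a_def b_def field_simps)
      then have s2: "a 2 + b 2 = 2 * e1" using \<open>d \<noteq> 0\<close> by (simp add: d_def)
      have s3: "a 2 / e2 + b 2 * e2 = 0" using e0 by (simp add: a_def b_def)
      have "amplitude_step t 0 k a b j" for j
      proof -
        consider "j = 0" | "j = 1" | "j = 2" | "j > 2" by linarith
        then show ?thesis
        proof cases
          case 1
          then show ?thesis by (auto simp: amplitude_step_def a_def b_def ph)
        next
          case 2
          then show ?thesis using s2 e1
            by (auto simp: amplitude_step_def ph numeral_2_eq_2) (auto simp: a_def b_def)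
        next
          case 3
          then show ?thesis using s3
            by (auto simp: amplitude_step_def ph) (auto simp: a_def b_def)
        next
          case 4
          then show ?thesis by (auto simp: amplitude_step_def a_def b_def)
        qed
      qed
      then have "resonant_amplitudes N t 0 k a b"
        using N by (auto simp: resonant_amplitudes_def a_def b_def intro!: exI[of _ 0])
      then show ?thesis by blast
    qed
  qed
qed

section \<open>Plane waves and the Helmholtz equation\<close>

text \<open>The derivative of a plane wave is again of this form, with amplitudes \<open>- \<i> \<kappa> a\<close> and \<open>\<i> \<kappa> b\<close>.
  Therefore derivatives are written as plane waves, too.\<close>

definition plane_wave :: "complex \<Rightarrow> real \<Rightarrow> complex \<Rightarrow> complex \<Rightarrow> real \<Rightarrow> complex" where
  "plane_wave \<kappa> p a b x =
     a * exp (- (\<i> * \<kappa> * of_real (x - p))) + b * exp (\<i> * \<kappa> * of_real (x - p))"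

lemma plane_has_vector_derivative:
  "(plane_wave \<kappa> p a b has_vector_derivative plane_wave \<kappa> p (- (\<i> * \<kappa> * a)) (\<i> * \<kappa> * b) x) (at x within S)"
proof -
  have "((\<lambda>z. a * exp (- (\<i> * \<kappa> * (z - of_real p))) + b * exp (\<i> * \<kappa> * (z - of_real p)))
      has_field_derivative plane_wave \<kappa> p (- (\<i> * \<kappa> * a)) (\<i> * \<kappa> * b) x) (at (of_real x))"
    unfolding plane_wave_def by (auto intro!: derivative_eq_intros simp: algebra_simps)
  from has_vector_derivative_real_field[OF this] show ?thesis
    unfolding plane_wave_def by simp
qed

lemma isCont_plane: "isCont (plane_wave \<kappa> p a b) x"
  by (rule has_vector_derivative_continuous[OF plane_has_vector_derivative])

lemma plane_anchor: "plane_wave \<kappa> p a b p = a + b"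
  by (simp add: plane_wave_def)

lemma plane_deriv_on:
  assumes "open S" "\<And>x. x \<in> S \<Longrightarrow> u x = plane_wave \<kappa> p a b x" "x \<in> S"
  shows "(u has_vector_derivative plane_wave \<kappa> p (- (\<i> * \<kappa> * a)) (\<i> * \<kappa> * b) x) (at x)"
  by (rule has_vector_derivative_transform_within_open[OF plane_has_vector_derivative assms(1,3)])
    (simp add: assms(2))

lemma vector_derivative_plane_on:
  assumes "open S" "\<And>x. x \<in> S \<Longrightarrow> u x = plane_wave \<kappa> p a b x" "x \<in> S"
  shows "vector_derivative u (at x) = plane_wave \<kappa> p (- (\<i> * \<kappa> * a)) (\<i> * \<kappa> * b) x"
  using plane_deriv_on[OF assms] by (rule vector_derivative_at)

lemma helmholtz_on_plane:
  assumes "open S" and u: "\<And>x. x \<in> S \<Longrightarrow> u x = plane_wave \<kappa> p a b x"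
  shows "helmholtz_on S \<kappa> u"
  unfolding helmholtz_on_def
proof (intro ballI conjI)
  fix x assume x: "x \<in> S"
  show "u differentiable at x"
    using plane_deriv_on[OF assms x] by (rule differentiableI_vector)
  have "((\<lambda>y. vector_derivative u (at y)) has_vector_derivative
      plane_wave \<kappa> p (- (\<i> * \<kappa> * - (\<i> * \<kappa> * a))) (\<i> * \<kappa> * (\<i> * \<kappa> * b)) x) (at x)"
    by (rule plane_deriv_on[OF assms(1) _ x]) (rule vector_derivative_plane_on[OF assms])
  moreover have "plane_wave \<kappa> p (- (\<i> * \<kappa> * - (\<i> * \<kappa> * a))) (\<i> * \<kappa> * (\<i> * \<kappa> * b)) x = - (\<kappa>\<^sup>2 * u x)"
    unfolding u[OF x] by (simp add: plane_wave_def power2_eq_square algebra_simps)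
  ultimately have *: "((\<lambda>y. vector_derivative u (at y)) has_vector_derivative - (\<kappa>\<^sup>2 * u x)) (at x)"
    by simp
  then show "(\<lambda>y. vector_derivative u (at y)) differentiable at x"
    by (rule differentiableI_vector)
  show "vector_derivative (\<lambda>y. vector_derivative u (at y)) (at x) + \<kappa>\<^sup>2 * u x = 0"
    using vector_derivative_at[OF *] by simp
qed

text \<open>The equation factors as \<open>(d/dx - \<i> \<kappa>) (d/dx + \<i> \<kappa>) u = 0\<close>, so \<open>(u' + \<i> \<kappa> u) exp (- \<i> \<kappa> x)\<close> has
  derivative zero.\<close>

lemma helmholtz_first_integral:
  assumes "helmholtz_on S \<kappa> u" "convex S"
  shows "\<exists>c. \<forall>x\<in>S. vector_derivative u (at x) + \<i> * \<kappa> * u x = c * exp (\<i> * \<kappa> * of_real (x - p))"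
proof -
  define F where "F x = (vector_derivative u (at x) + \<i> * \<kappa> * u x) * exp (- (\<i> * \<kappa> * of_real (x - p)))" for x
  have "(F has_vector_derivative 0) (at x within S)" if "x \<in> S" for x
  proof -
    have u: "(u has_vector_derivative vector_derivative u (at x)) (at x)"
      using assms(1) that unfolding helmholtz_on_def by (simp add: vector_derivative_works[symmetric])
    have "((\<lambda>y. vector_derivative u (at y)) has_vector_derivative
        vector_derivative (\<lambda>y. vector_derivative u (at y)) (at x)) (at x)"
      using assms(1) that unfolding helmholtz_on_def by (simp add: vector_derivative_works[symmetric])
    moreover have "vector_derivative (\<lambda>y. vector_derivative u (at y)) (at x) = - (\<kappa>\<^sup>2 * u x)"
      using assms(1) that unfolding helmholtz_on_def by (simp add: eq_neg_iff_add_eq_0)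
    ultimately have u': "((\<lambda>y. vector_derivative u (at y)) has_vector_derivative - (\<kappa>\<^sup>2 * u x)) (at x)"
      by simp
    have e: "((\<lambda>x. exp (- (\<i> * \<kappa> * of_real (x - p)))) has_vector_derivative
        - (\<i> * \<kappa>) * exp (- (\<i> * \<kappa> * of_real (x - p)))) (at x)"
    proof -
      have "plane_wave \<kappa> p 1 0 = (\<lambda>x. exp (- (\<i> * \<kappa> * of_real (x - p))))"
        by (simp add: plane_wave_def fun_eq_iff)
      then show ?thesis
        using plane_has_vector_derivative[of \<kappa> p 1 0 x UNIV] by (simp add: plane_wave_def)
    qed
    have "(F has_vector_derivative
        (vector_derivative u (at x) + \<i> * \<kappa> * u x) * (- (\<i> * \<kappa>) * exp (- (\<i> * \<kappa> * of_real (x - p)))) +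
        (- (\<kappa>\<^sup>2 * u x) + \<i> * \<kappa> * vector_derivative u (at x)) * exp (- (\<i> * \<kappa> * of_real (x - p)))) (at x)"
      unfolding F_def
      by (intro has_vector_derivative_mult has_vector_derivative_add has_vector_derivative_mult_right u u' e)
    moreover have "(vector_derivative u (at x) + \<i> * \<kappa> * u x) * (- (\<i> * \<kappa>) * exp (- (\<i> * \<kappa> * of_real (x - p)))) +
        (- (\<kappa>\<^sup>2 * u x) + \<i> * \<kappa> * vector_derivative u (at x)) * exp (- (\<i> * \<kappa> * of_real (x - p))) = 0"
      by (simp add: algebra_simps power2_eq_square)
    ultimately show ?thesis by (simp add: has_vector_derivative_at_within)
  qed
  from has_vector_derivative_zero_constant[OF assms(2) this]
  obtain c where c: "\<And>x. x \<in> S \<Longrightarrow> F x = c" by blast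
  have "vector_derivative u (at x) + \<i> * \<kappa> * u x = c * exp (\<i> * \<kappa> * of_real (x - p))" if "x \<in> S" for x
    unfolding c[OF that, symmetric] F_def by (simp only: mult.assoc mult_exp_exp) simp
  then show ?thesis by blast
qed

text \<open>Replacing \<open>\<kappa>\<close> by \<open>- \<kappa>\<close> gives a second first integral; for \<open>\<kappa> \<noteq> 0\<close> the difference of the two
  determines \<open>u\<close>.\<close>

lemma helmholtz_on_imp_plane:
  assumes "helmholtz_on S \<kappa> u" "convex S" "\<kappa> \<noteq> 0"
  shows "\<exists>a b. \<forall>x\<in>S. u x = plane_wave \<kappa> p a b x"
proof -
  obtain c where c: "\<And>x. x \<in> S \<Longrightarrow>
      vector_derivative u (at x) + \<i> * \<kappa> * u x = c * exp (\<i> * \<kappa> * of_real (x - p))"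
    using helmholtz_first_integral[OF assms(1,2)] by blast
  have "helmholtz_on S (- \<kappa>) u" using assms(1) by (simp add: helmholtz_on_def)
  then obtain d where "\<And>x. x \<in> S \<Longrightarrow>
      vector_derivative u (at x) + \<i> * - \<kappa> * u x = d * exp (\<i> * - \<kappa> * of_real (x - p))"
    using helmholtz_first_integral[OF _ assms(2)] by blast
  then have d: "vector_derivative u (at x) - \<i> * \<kappa> * u x = d * exp (- (\<i> * \<kappa> * of_real (x - p)))"
    if "x \<in> S" for x
    using that by simp
  have "u x = plane_wave \<kappa> p (- d / (2 * \<i> * \<kappa>)) (c / (2 * \<i> * \<kappa>)) x" if "x \<in> S" for x
  proof -
    have "2 * \<i> * \<kappa> * u x = (vector_derivative u (at x) + \<i> * \<kappa> * u x) - (vector_derivative u (at x) - \<i> * \<kappa> * u x)"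
      by simp
    also have "\<dots> = 2 * \<i> * \<kappa> * plane_wave \<kappa> p (- d / (2 * \<i> * \<kappa>)) (c / (2 * \<i> * \<kappa>)) x"
      unfolding c[OF that] d[OF that] using assms(3) by (simp add: plane_wave_def field_simps)
    finally show ?thesis using assms(3) by simp
  qed
  then show ?thesis by blast
qed

lemma plane_zero_imp:
  assumes "open S" "x \<in> S" "\<And>x. x \<in> S \<Longrightarrow> plane_wave \<kappa> p a b x = 0" "\<kappa> \<noteq> 0"
  shows "a = 0 \<and> b = 0"
proof -
  have "plane_wave \<kappa> p (- (\<i> * \<kappa> * a)) (\<i> * \<kappa> * b) x = 0"
    using vector_derivative_plane_on[of S "\<lambda>_. 0" \<kappa> p a b x] assms by simp
  then have "\<i> * \<kappa> * (b * exp (\<i> * \<kappa> * of_real (x - p)) - a * exp (- (\<i> * \<kappa> * of_real (x - p)))) = 0"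
    by (simp add: plane_wave_def algebra_simps)
  then have "b * exp (\<i> * \<kappa> * of_real (x - p)) = a * exp (- (\<i> * \<kappa> * of_real (x - p)))"
    using assms(4) by simp
  moreover have "a * exp (- (\<i> * \<kappa> * of_real (x - p))) + b * exp (\<i> * \<kappa> * of_real (x - p)) = 0"
    using assms(3)[OF assms(2)] by (simp add: plane_wave_def)
  ultimately show ?thesis by simp
qed

lemma flux_jump_iff:
  assumes "((\<lambda>y. vector_derivative u (at y)) \<longlongrightarrow> a) F" "((\<lambda>y. vector_derivative u (at y)) \<longlongrightarrow> b) G"
    and "F \<noteq> bot" "G \<noteq> bot"
  shows "flux_jump \<delta> u F G \<longleftrightarrow> a = \<delta> * b"
proof
  assume "flux_jump \<delta> u F G"
  then obtain a' b' where *: "((\<lambda>y. vector_derivative u (at y)) \<longlongrightarrow> a') F"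
      "((\<lambda>y. vector_derivative u (at y)) \<longlongrightarrow> b') G" "a' = \<delta> * b'"
    unfolding flux_jump_def by blast
  have "a' = a" by (rule tendsto_unique[OF assms(3) *(1) assms(1)])
  moreover have "b' = b" by (rule tendsto_unique[OF assms(4) *(2) assms(2)])
  ultimately show "a = \<delta> * b" using *(3) by simp
qed (use assms(1,2) in \<open>auto simp: flux_jump_def\<close>)

lemma isCont_iff_one_sided_limits:
  fixes u :: "real \<Rightarrow> complex"
  assumes "(u \<longlongrightarrow> l) (at_left y)" "(u \<longlongrightarrow> l') (at_right y)"
  shows "isCont u y \<longleftrightarrow> u y = l' \<and> l = l'"
proof
  assume "isCont u y"
  then have "(u \<longlongrightarrow> u y) (at_left y)" "(u \<longlongrightarrow> u y) (at_right y)"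
    by (auto simp: isCont_def filterlim_at_split)
  from tendsto_unique[OF _ assms(1) this(1)] tendsto_unique[OF _ assms(2) this(2)]
  show "u y = l' \<and> l = l'" by simp
qed (use assms in \<open>auto simp: isCont_def filterlim_at_split\<close>)

lemma plane_limits:
  assumes "open S" "\<And>x. x \<in> S \<Longrightarrow> u x = plane_wave \<kappa> p a b x" "eventually (\<lambda>x. x \<in> S) (at y within T)"
  shows "(u \<longlongrightarrow> plane_wave \<kappa> p a b y) (at y within T)"
    "((\<lambda>x. vector_derivative u (at x)) \<longlongrightarrow> plane_wave \<kappa> p (- (\<i> * \<kappa> * a)) (\<i> * \<kappa> * b) y) (at y within T)"
proof -
  have lim: "(plane_wave \<kappa> p a b \<longlongrightarrow> plane_wave \<kappa> p a b y) (at y within T)" for a b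
    using continuous_at_imp_continuous_at_within[OF isCont_plane] by (simp add: continuous_within)
  show "(u \<longlongrightarrow> plane_wave \<kappa> p a b y) (at y within T)"
    by (rule Lim_transform_eventually[OF lim]) (use assms(3) in eventually_elim, simp add: assms(2))
  show "((\<lambda>x. vector_derivative u (at x)) \<longlongrightarrow> plane_wave \<kappa> p (- (\<i> * \<kappa> * a)) (\<i> * \<kappa> * b) y) (at y within T)"
    by (rule Lim_transform_eventually[OF lim])
      (use assms(3) in eventually_elim, simp add: vector_derivative_plane_on[OF assms(1,2)])
qed

section \<open>The cells between consecutive interfaces\<close>

text \<open>The end points of all resonators in one increasing sequence with indices \<open>1, \<dots>, 2 N\<close>.\<close>

definition interface :: "(nat \<Rightarrow> real) \<Rightarrow> (nat \<Rightarrow> real) \<Rightarrow> nat \<Rightarrow> real" where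
  "interface xm xp j = (if odd j then xm ((j + 1) div 2) else xp (j div 2))"

locale resonator_array =
  fixes N :: nat and xm xp :: "nat \<Rightarrow> real"
  assumes chain: "resonator_chain N xm xp"
begin

abbreviation y :: "nat \<Rightarrow> real" where "y \<equiv> interface xm xp"

text \<open>Cells \<open>0\<close> and \<open>2 N\<close> are half lines; the odd cells are the resonators.\<close>

definition cell :: "nat \<Rightarrow> real set" where
  "cell j = {x. (0 < j \<longrightarrow> y j < x) \<and> (j < 2 * N \<longrightarrow> x < y (Suc j))}"

lemma N_pos: "N \<ge> 1"
  using chain by (simp add: resonator_chain_def)

lemma y_less_Suc: "1 \<le> j \<Longrightarrow> j < 2 * N \<Longrightarrow> y j < y (Suc j)"
proof (cases "odd j")
  case True
  assume "1 \<le> j" "j < 2 * N"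
  then have "(j + 1) div 2 \<in> {1..N}" by auto
  then show ?thesis using chain True by (auto simp: resonator_chain_def interface_def)
next
  case False
  assume "1 \<le> j" "j < 2 * N"
  with False have "j div 2 \<in> {1..<N}" by (auto elim!: evenE)
  then show ?thesis using chain False by (auto simp: resonator_chain_def interface_def)
qed

lemma y_less: "1 \<le> i \<Longrightarrow> i < j \<Longrightarrow> j \<le> 2 * N \<Longrightarrow> y i < y j"
proof (induction j)
  case (Suc j)
  then show ?case using y_less_Suc[of j] by (cases "i = j") auto
qed simp

lemma y_le: "1 \<le> i \<Longrightarrow> i \<le> j \<Longrightarrow> j \<le> 2 * N \<Longrightarrow> y i \<le> y j"
  using y_less[of i j] by (cases "i = j") auto

lemma open_cell: "open (cell j)"
proof -
  have "cell j = (if 0 < j then {y j<..} else UNIV) \<inter> (if j < 2 * N then {..<y (Suc j)} else UNIV)"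
    by (auto simp: cell_def)
  then show ?thesis by auto
qed

lemma convex_cell: "convex (cell j)"
proof -
  have "cell j = (if 0 < j then {y j<..} else UNIV) \<inter> (if j < 2 * N then {..<y (Suc j)} else UNIV)"
    by (auto simp: cell_def)
  then show ?thesis by (auto intro: convex_Int)
qed

lemma cell_nonempty: "j \<le> 2 * N \<Longrightarrow> cell j \<noteq> {}"
proof -
  assume j: "j \<le> 2 * N"
  consider "j = 0" | "j = 2 * N" "j > 0" | "0 < j" "j < 2 * N" using j by linarith
  then have "\<exists>x. x \<in> cell j"
  proof cases
    case 1
    then show ?thesis by (auto simp: cell_def intro: exI[of _ "y 1 - 1"])
  next
    case 2
    then show ?thesis by (auto simp: cell_def intro: exI[of _ "y j + 1"])
  next
    case 3
    then show ?thesis using dense[OF y_less_Suc[of j]] by (auto simp: cell_def)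
  qed
  then show ?thesis by blast
qed

text \<open>An interface point counts to the cell on its right.\<close>

definition cell_index :: "real \<Rightarrow> nat" where
  "cell_index x = card {j\<in>{1..2 * N}. y j \<le> x}"

lemma cell_index_cell: "j \<le> 2 * N \<Longrightarrow> x \<in> cell j \<Longrightarrow> cell_index x = j"
proof -
  assume j: "j \<le> 2 * N" "x \<in> cell j"
  have "{i\<in>{1..2 * N}. y i \<le> x} = {1..j}"
  proof (intro set_eqI iffI)
    fix i assume i: "i \<in> {i\<in>{1..2 * N}. y i \<le> x}"
    show "i \<in> {1..j}"
    proof (rule ccontr)
      assume "i \<notin> {1..j}"
      then have "y (Suc j) \<le> y i" "j < 2 * N" using i by (auto intro!: y_le)
      then show False using i j by (auto simp: cell_def)
    qed
  next
    fix i assume i: "i \<in> {1..j}"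
    then have "y i \<le> y j" using j(1) by (auto intro!: y_le)
    then show "i \<in> {i\<in>{1..2 * N}. y i \<le> x}" using i j by (auto simp: cell_def)
  qed
  then show ?thesis by (simp add: cell_index_def)
qed

lemma cell_index_y: "1 \<le> j \<Longrightarrow> j \<le> 2 * N \<Longrightarrow> cell_index (y j) = j"
proof -
  assume j: "1 \<le> j" "j \<le> 2 * N"
  have "{i\<in>{1..2 * N}. y i \<le> y j} = {1..j}"
    using j y_le y_less by (auto simp: not_le[symmetric]) (meson not_le)
  then show ?thesis by (simp add: cell_index_def)
qed

lemma cell_exhaust:
  assumes "\<And>j. 1 \<le> j \<Longrightarrow> j \<le> 2 * N \<Longrightarrow> x \<noteq> y j"
  obtains j where "j \<le> 2 * N" "x \<in> cell j"
proof (cases "\<exists>j\<in>{1..2 * N}. y j < x")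
  case False
  then have "x \<in> cell 0" using assms[of 1] N_pos by (force simp: cell_def)
  then show ?thesis using that by blast
next
  case True
  define j where "j = Max {j\<in>{1..2 * N}. y j < x}"
  have j: "j \<in> {j\<in>{1..2 * N}. y j < x}"
    unfolding j_def using True by (intro Max_in) auto
  have "\<not> y (Suc j) < x" if "j < 2 * N"
  proof
    assume "y (Suc j) < x"
    then have "Suc j \<le> j" unfolding j_def using that by (intro Max_ge) (auto simp: j_def)
    then show False by simp
  qed
  then have "x \<in> cell j" using j assms[of "Suc j"] by (force simp: cell_def)
  then show ?thesis using that j by auto
qed

lemma resonators_eq: "resonators N xm xp = (\<Union>j\<in>{j. odd j \<and> j < 2 * N}. cell j)"
proof -
  have *: "{xm j<..<xp j} = cell (2 * j - 1)" if "j \<in> {1..N}" for j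
    using that by (cases j) (auto simp: cell_def interface_def)
  show ?thesis
  proof (intro set_eqI iffI)
    fix x assume "x \<in> resonators N xm xp"
    then obtain j where j: "j \<in> {1..N}" "x \<in> {xm j<..<xp j}" by (auto simp: resonators_def)
    moreover have "odd (2 * j - 1)" "2 * j - 1 < 2 * N" using j(1) by auto
    ultimately show "x \<in> (\<Union>j\<in>{j. odd j \<and> j < 2 * N}. cell j)" using * by blast
  next
    fix x assume "x \<in> (\<Union>j\<in>{j. odd j \<and> j < 2 * N}. cell j)"
    then obtain i where i: "odd i" "i < 2 * N" "x \<in> cell i" by blast
    define j where "j = (i + 1) div 2"
    have "j \<in> {1..N}" "2 * j - 1 = i" using i by (auto simp: j_def elim!: oddE)
    then have "j \<in> {1..N}" "x \<in> {xm j<..<xp j}" using *[of j] i(3) by simp_all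
    then show "x \<in> resonators N xm xp" unfolding resonators_def by blast
  qed
qed

lemma cell_disjoint: "i \<le> 2 * N \<Longrightarrow> j \<le> 2 * N \<Longrightarrow> x \<in> cell i \<Longrightarrow> x \<in> cell j \<Longrightarrow> i = j"
  using cell_index_cell by metis

lemma eventually_cell_left: "j < 2 * N \<Longrightarrow> eventually (\<lambda>x. x \<in> cell j) (at_left (y (Suc j)))"
proof (cases "j = 0")
  case True
  assume "j < 2 * N"
  then show ?thesis
    using True by (auto simp: cell_def eventually_at_filter)
next
  case False
  assume j: "j < 2 * N"
  have "eventually (\<lambda>x. x \<in> {y j<..<y (Suc j)}) (at_left (y (Suc j)))"
    using j False y_less_Suc by (intro eventually_at_left_real) auto
  then show ?thesis by eventually_elim (auto simp: cell_def)
qed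

lemma eventually_cell_right:
  "1 \<le> j \<Longrightarrow> j \<le> 2 * N \<Longrightarrow> eventually (\<lambda>x. x \<in> cell j) (at_right (y j))"
proof (cases "j = 2 * N")
  case True
  assume "1 \<le> j"
  then show ?thesis
    using True by (auto simp: cell_def eventually_at_filter)
next
  case False
  assume j: "1 \<le> j" "j \<le> 2 * N"
  have "eventually (\<lambda>x. x \<in> {y j<..<y (Suc j)}) (at_right (y j))"
    using j False y_less_Suc by (intro eventually_at_right_real) auto
  then show ?thesis by eventually_elim (auto simp: cell_def)
qed

text \<open>An interface point is an end point of a resonator, so it is not in the interior of the complement.\<close>

lemma interior_complement_eq: "interior (- resonators N xm xp) = (\<Union>j\<in>{j. even j \<and> j \<le> 2 * N}. cell j)"
proof (intro set_eqI iffI)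
  fix x assume x: "x \<in> interior (- resonators N xm xp)"
  have "x \<noteq> y j" if j: "1 \<le> j" "j \<le> 2 * N" for j
  proof
    assume "x = y j"
    have ev: "eventually (\<lambda>z. z \<in> - resonators N xm xp) (nhds x)"
      using eventually_nhds_in_open[OF open_interior x]
      by (rule eventually_mono) (use interior_subset in blast)
    show False
    proof (cases "odd j")
      case True
      have "eventually (\<lambda>z. z \<in> cell j) (at_right x)"
        using eventually_cell_right[OF j] \<open>x = y j\<close> by simp
      moreover have "eventually (\<lambda>z. z \<in> - resonators N xm xp) (at_right x)"
        using ev by (auto simp: eventually_at_filter elim: eventually_mono)
      ultimately have "eventually (\<lambda>z. z \<in> cell j \<and> z \<in> - resonators N xm xp) (at_right x)"
        by (rule eventually_conj)
      then obtain z where "z \<in> cell j" "z \<notin> resonators N xm xp"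
        using eventually_happens'[OF trivial_limit_at_right_real] by blast
      moreover have "j < 2 * N" using True j by (cases "j = 2 * N") auto
      ultimately show False using True unfolding resonators_eq by blast
    next
      case False
      then obtain i where i: "j = Suc i" "odd i" "i < 2 * N" using j by (cases j) auto
      have "eventually (\<lambda>z. z \<in> cell i) (at_left x)"
        using eventually_cell_left[OF i(3)] \<open>x = y j\<close> i(1) by simp
      moreover have "eventually (\<lambda>z. z \<in> - resonators N xm xp) (at_left x)"
        using ev by (auto simp: eventually_at_filter elim: eventually_mono)
      ultimately have "eventually (\<lambda>z. z \<in> cell i \<and> z \<in> - resonators N xm xp) (at_left x)"
        by (rule eventually_conj)
      then obtain z where "z \<in> cell i" "z \<notin> resonators N xm xp"
        using eventually_happens'[OF trivial_limit_at_left_real] by blast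
      then show False using i unfolding resonators_eq by blast
    qed
  qed
  then obtain j where j: "j \<le> 2 * N" "x \<in> cell j" by (rule cell_exhaust)
  have "x \<notin> resonators N xm xp" using x interior_subset by blast
  then have "even j" using j unfolding resonators_eq by (cases "j = 2 * N") (auto simp: le_less)
  then show "x \<in> (\<Union>j\<in>{j. even j \<and> j \<le> 2 * N}. cell j)" using j by blast
next
  fix x assume "x \<in> (\<Union>j\<in>{j. even j \<and> j \<le> 2 * N}. cell j)"
  then obtain j where j: "even j" "j \<le> 2 * N" "x \<in> cell j" by blast
  have "cell j \<subseteq> - resonators N xm xp"
  proof
    fix z assume z: "z \<in> cell j"
    have "z \<notin> cell i" if "odd i" "i < 2 * N" for i
    proof
      assume "z \<in> cell i"
      with z have "i = j" using that(2) j(2) by (intro cell_disjoint[of i j z]) auto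
      then show False using that(1) j(1) by simp
    qed
    then show "z \<in> - resonators N xm xp"
      unfolding resonators_eq by blast
  qed
  then show "x \<in> interior (- resonators N xm xp)"
    using j open_cell interior_maximal by blast
qed

end

lemma plane_radiation:
  assumes "open S" "S \<noteq> {}" "\<And>x. x \<in> S \<Longrightarrow> u x = plane_wave \<kappa> p a b x" "\<kappa> \<noteq> 0"
  shows "(\<forall>x\<in>S. - vector_derivative u (at x) - \<i> * \<kappa> * u x = 0) \<longleftrightarrow> b = 0"
    and "(\<forall>x\<in>S. vector_derivative u (at x) - \<i> * \<kappa> * u x = 0) \<longleftrightarrow> a = 0"
proof -
  have du: "vector_derivative u (at x) = plane_wave \<kappa> p (- (\<i> * \<kappa> * a)) (\<i> * \<kappa> * b) x" if "x \<in> S" for x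
    by (rule vector_derivative_plane_on[OF assms(1,3) that])
  have "- vector_derivative u (at x) - \<i> * \<kappa> * u x = - 2 * \<i> * \<kappa> * exp (\<i> * \<kappa> * of_real (x - p)) * b"
    "vector_derivative u (at x) - \<i> * \<kappa> * u x = - 2 * \<i> * \<kappa> * exp (- (\<i> * \<kappa> * of_real (x - p))) * a"
    if "x \<in> S" for x
    using that by (simp_all add: du assms(3) plane_wave_def algebra_simps)
  then show "(\<forall>x\<in>S. - vector_derivative u (at x) - \<i> * \<kappa> * u x = 0) \<longleftrightarrow> b = 0"
    "(\<forall>x\<in>S. vector_derivative u (at x) - \<i> * \<kappa> * u x = 0) \<longleftrightarrow> a = 0"
    using assms(2,4) by auto
qed

context resonator_array
begin

definition transmits :: "complex \<Rightarrow> (real \<Rightarrow> complex) \<Rightarrow> nat \<Rightarrow> bool" where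
  "transmits \<delta> u j \<longleftrightarrow> isCont u (y (Suc j)) \<and>
     (if even j then flux_jump \<delta> u (at_right (y (Suc j))) (at_left (y (Suc j)))
      else flux_jump \<delta> u (at_left (y (Suc j))) (at_right (y (Suc j))))"

lemma transmits_all_iff:
  "(\<forall>j\<in>{1..N}. isCont u (xm j) \<and> isCont u (xp j) \<and>
      flux_jump \<delta> u (at_right (xm j)) (at_left (xm j)) \<and>
      flux_jump \<delta> u (at_left (xp j)) (at_right (xp j))) \<longleftrightarrow> (\<forall>j<2 * N. transmits \<delta> u j)"
proof -
  have pair: "isCont u (xm (Suc m)) \<and> isCont u (xp (Suc m)) \<and>
      flux_jump \<delta> u (at_right (xm (Suc m))) (at_left (xm (Suc m))) \<and>
      flux_jump \<delta> u (at_left (xp (Suc m))) (at_right (xp (Suc m))) \<longleftrightarrow>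
      transmits \<delta> u (2 * m) \<and> transmits \<delta> u (2 * m + 1)" for m
    by (auto simp: transmits_def interface_def)
  have range: "{1..N} = Suc ` {..<N}"
    by (simp add: image_Suc_lessThan)
  have "(\<forall>j\<in>{1..N}. isCont u (xm j) \<and> isCont u (xp j) \<and>
      flux_jump \<delta> u (at_right (xm j)) (at_left (xm j)) \<and>
      flux_jump \<delta> u (at_left (xp j)) (at_right (xp j))) \<longleftrightarrow>
      (\<forall>m<N. transmits \<delta> u (2 * m) \<and> transmits \<delta> u (2 * m + 1))"
    unfolding range ball_simps pair by (simp add: Ball_def)
  also have "\<dots> \<longleftrightarrow> (\<forall>j<2 * N. transmits \<delta> u j)"
  proof (intro iffI allI impI)
    fix j assume *: "\<forall>m<N. transmits \<delta> u (2 * m) \<and> transmits \<delta> u (2 * m + 1)" and "j < 2 * N"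
    then show "transmits \<delta> u j" by (cases "even j") (auto elim!: evenE oddE)
  qed auto
  finally show ?thesis .
qed

lemma cell_0: "cell 0 = {..<xm 1}" and cell_last: "cell (2 * N) = {xp N<..}"
  using N_pos by (auto simp: cell_def interface_def)

lemma scattering_solution_iff:
  "scattering_solution N xm xp v vb \<delta> \<omega> u \<longleftrightarrow>
     (\<forall>j\<le>2 * N. helmholtz_on (cell j) (if odd j then \<omega> / of_real vb else \<omega> / of_real v) u) \<and>
     (\<forall>j<2 * N. transmits \<delta> u j) \<and>
     (\<forall>x\<in>cell 0. - vector_derivative u (at x) - \<i> * (\<omega> / of_real v) * u x = 0) \<and>
     (\<forall>x\<in>cell (2 * N). vector_derivative u (at x) - \<i> * (\<omega> / of_real v) * u x = 0)"
proof -
  have H: "helmholtz_on (\<Union>j\<in>J. cell j) \<kappa> u \<longleftrightarrow> (\<forall>j\<in>J. helmholtz_on (cell j) \<kappa> u)" for J \<kappa>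
    by (auto simp: helmholtz_on_def)
  have "(\<forall>j\<le>2 * N. helmholtz_on (cell j) (if odd j then \<omega> / of_real vb else \<omega> / of_real v) u) \<longleftrightarrow>
      helmholtz_on (interior (- resonators N xm xp)) (\<omega> / of_real v) u \<and>
      helmholtz_on (resonators N xm xp) (\<omega> / of_real vb) u"
    unfolding interior_complement_eq unfolding resonators_eq H
  proof (intro iffI conjI ballI allI impI)
    fix j
    assume *: "(\<forall>j\<in>{j. even j \<and> j \<le> 2 * N}. helmholtz_on (cell j) (\<omega> / of_real v) u) \<and>
        (\<forall>j\<in>{j. odd j \<and> j < 2 * N}. helmholtz_on (cell j) (\<omega> / of_real vb) u)" and "j \<le> 2 * N"
    then have "odd j \<Longrightarrow> j < 2 * N" by (cases "j = 2 * N") auto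
    then show "helmholtz_on (cell j) (if odd j then \<omega> / of_real vb else \<omega> / of_real v) u"
      using * \<open>j \<le> 2 * N\<close> by (cases "odd j") simp_all
  next
    fix j
    assume *: "\<forall>j\<le>2 * N. helmholtz_on (cell j) (if odd j then \<omega> / of_real vb else \<omega> / of_real v) u"
    show "helmholtz_on (cell j) (\<omega> / of_real v) u" if "j \<in> {j. even j \<and> j \<le> 2 * N}"
      using *[rule_format, of j] that by simp
    show "helmholtz_on (cell j) (\<omega> / of_real vb) u" if "j \<in> {j. odd j \<and> j < 2 * N}"
      using *[rule_format, of j] that by simp
  qed
  then show ?thesis
    unfolding scattering_solution_def Let_def transmits_all_iff cell_0 cell_last
    by (simp only: Ball_def lessThan_iff greaterThan_iff conj_assoc)
qed

text \<open>The derivative of a wave has the factor \<open>\<i> k\<close> outside the resonators and \<open>\<i> r k\<close> inside. The quotient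
  of the two turns the factor \<open>\<delta>\<close> of the flux condition into \<open>\<sigma> = \<delta> / r\<close>.\<close>

lemma transmits_iff_amplitude_step:
  fixes a b :: "nat \<Rightarrow> complex"
  assumes v: "v > 0" "vb > 0" and "\<omega> \<noteq> 0" and j: "j < 2 * N"
  defines "k \<equiv> \<omega> / of_real v"
  defines "r \<equiv> v / vb"
  defines "W \<equiv> \<lambda>j. plane_wave (if odd j then \<omega> / of_real vb else k) (y (max 1 j)) (a j) (b j)"
  assumes u: "\<And>x. x \<in> cell j \<Longrightarrow> u x = W j x" "\<And>x. x \<in> cell (Suc j) \<Longrightarrow> u x = W (Suc j) x"
  shows "transmits \<delta> u j \<longleftrightarrow> u (y (Suc j)) = a (Suc j) + b (Suc j) \<and>
    amplitude_step (travel_times r xm xp) (\<delta> / of_real r) k a b j"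
proof -
  define t where "t = travel_times r xm xp"
  define \<kappa> where "\<kappa> j = (if odd j then \<omega> / of_real vb else k)" for j :: nat
  have kb: "\<omega> / of_real vb = of_real r * k" using v by (simp add: r_def k_def)
  have k: "k \<noteq> 0" "r \<noteq> 0" using v \<open>\<omega> \<noteq> 0\<close> by (auto simp: k_def r_def)
  define Y where "Y = y (Suc j)"
  have phase: "phase t k j = exp (\<i> * \<kappa> j * of_real (Y - y (max 1 j)))"
  proof (cases "j = 0")
    case False
    then have "of_real (t j) * k = \<kappa> j * of_real (Y - y j)"
      by (auto simp: t_def travel_times_def \<kappa>_def kb interface_def Y_def)
    with False show ?thesis by (simp add: phase_def mult.assoc max_def)
  qed (simp add: phase_def Y_def)
  have left: "plane_wave (\<kappa> j) (y (max 1 j)) c d Y = c / phase t k j + d * phase t k j" for c d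
    unfolding phase plane_wave_def by (simp add: exp_minus divide_inverse)
  have right: "plane_wave (\<kappa> (Suc j)) (y (max 1 (Suc j))) c d Y = c + d" for c d
    by (simp add: plane_anchor Y_def)
  have W: "W i = plane_wave (\<kappa> i) (y (max 1 i)) (a i) (b i)" for i
    unfolding W_def \<kappa>_def ..
  have evL: "eventually (\<lambda>x. x \<in> cell j) (at_left Y)"
    using eventually_cell_left[OF j] by (simp add: Y_def)
  have evR: "eventually (\<lambda>x. x \<in> cell (Suc j)) (at_right Y)"
    using eventually_cell_right[of "Suc j"] j by (simp add: Y_def)
  note L = plane_limits[OF open_cell u(1)[unfolded W] evL, unfolded left]
  note R = plane_limits[OF open_cell u(2)[unfolded W] evR, unfolded right]
  define x z where "x = a j / phase t k j" and "z = b j * phase t k j"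
  have cont: "isCont u Y \<longleftrightarrow> u Y = a (Suc j) + b (Suc j) \<and> x + z = a (Suc j) + b (Suc j)"
    using isCont_iff_one_sided_limits[OF L(1) R(1)] by (simp add: x_def z_def)
  have "(- (\<i> * \<kappa> j * a j)) / phase t k j + (\<i> * \<kappa> j * b j) * phase t k j = \<i> * \<kappa> j * (z - x)"
    by (simp add: x_def z_def algebra_simps)
  note L' = L(2)[unfolded this]
  have "- (\<i> * \<kappa> (Suc j) * a (Suc j)) + \<i> * \<kappa> (Suc j) * b (Suc j) = \<i> * \<kappa> (Suc j) * (b (Suc j) - a (Suc j))"
    by (simp add: algebra_simps)
  note R' = R(2)[unfolded this]
  show ?thesis
  proof (cases "even j")
    case True
    have "flux_jump \<delta> u (at_right Y) (at_left Y) \<longleftrightarrow>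
        \<i> * \<kappa> (Suc j) * (b (Suc j) - a (Suc j)) = \<delta> * (\<i> * \<kappa> j * (z - x))"
      by (rule flux_jump_iff[OF R' L']) simp_all
    also have "\<dots> \<longleftrightarrow> b (Suc j) - a (Suc j) = \<delta> / of_real r * (z - x)"
    proof -
      have "\<i> * \<kappa> (Suc j) * (b (Suc j) - a (Suc j)) = \<i> * k * (of_real r * (b (Suc j) - a (Suc j)))"
        "\<delta> * (\<i> * \<kappa> j * (z - x)) = \<i> * k * (\<delta> * (z - x))"
        using True by (simp_all add: \<kappa>_def kb)
      then have "\<i> * \<kappa> (Suc j) * (b (Suc j) - a (Suc j)) = \<delta> * (\<i> * \<kappa> j * (z - x)) \<longleftrightarrow>
          of_real r * (b (Suc j) - a (Suc j)) = \<delta> * (z - x)"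
        using k(1) by (metis mult_left_cancel no_zero_divisors complex_i_not_zero)
      also have "\<dots> \<longleftrightarrow> b (Suc j) - a (Suc j) = \<delta> / of_real r * (z - x)"
        using k(2) by (auto simp: field_simps)
      finally show ?thesis .
    qed
    finally show ?thesis
      using True cont by (auto simp: transmits_def amplitude_step_def Let_def Y_def x_def z_def t_def)
  next
    case False
    have "flux_jump \<delta> u (at_left Y) (at_right Y) \<longleftrightarrow>
        \<i> * \<kappa> j * (z - x) = \<delta> * (\<i> * \<kappa> (Suc j) * (b (Suc j) - a (Suc j)))"
      by (rule flux_jump_iff[OF L' R']) simp_all
    also have "\<dots> \<longleftrightarrow> \<delta> / of_real r * (b (Suc j) - a (Suc j)) = z - x"
    proof -
      have "\<i> * \<kappa> j * (z - x) = \<i> * k * (of_real r * (z - x))"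
        "\<delta> * (\<i> * \<kappa> (Suc j) * (b (Suc j) - a (Suc j))) = \<i> * k * (\<delta> * (b (Suc j) - a (Suc j)))"
        using False by (simp_all add: \<kappa>_def kb)
      then have "\<i> * \<kappa> j * (z - x) = \<delta> * (\<i> * \<kappa> (Suc j) * (b (Suc j) - a (Suc j))) \<longleftrightarrow>
          of_real r * (z - x) = \<delta> * (b (Suc j) - a (Suc j))"
        using k(1) by (metis mult_left_cancel no_zero_divisors complex_i_not_zero)
      also have "\<dots> \<longleftrightarrow> \<delta> / of_real r * (b (Suc j) - a (Suc j)) = z - x"
        using k(2) by (auto simp: field_simps)
      finally show ?thesis .
    qed
    finally show ?thesis
      using False cont by (auto simp: transmits_def amplitude_step_def Let_def Y_def x_def z_def t_def)
  qed
qed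

text \<open>The anchor of layer \<open>j\<close> is its left end; layer \<open>0\<close> has none and uses the first interface.\<close>

definition wave ::
  "complex \<Rightarrow> complex \<Rightarrow> (nat \<Rightarrow> complex) \<Rightarrow> (nat \<Rightarrow> complex) \<Rightarrow> nat \<Rightarrow> real \<Rightarrow> complex" where
  "wave k kb a b j = plane_wave (if odd j then kb else k) (y (max 1 j)) (a j) (b j)"

lemma scattering_solution_wave_iff:
  assumes v: "v > 0" "vb > 0" and \<omega>: "\<omega> \<noteq> 0"
    and k_def: "k = \<omega> / of_real v" and t_def: "t = travel_times (v / vb) xm xp"
    and \<sigma>_def: "\<sigma> = \<delta> / of_real (v / vb)"
    and u: "\<And>j x. j \<le> 2 * N \<Longrightarrow> x \<in> cell j \<Longrightarrow> u x = wave k (\<omega> / of_real vb) a b j x"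
  shows "scattering_solution N xm xp v vb \<delta> \<omega> u \<longleftrightarrow>
      (\<forall>j<2 * N. u (y (Suc j)) = a (Suc j) + b (Suc j) \<and> amplitude_step t \<sigma> k a b j) \<and>
      b 0 = 0 \<and> a (2 * N) = 0"
proof -
  have k: "k \<noteq> 0" using v \<omega> by (simp add: k_def)
  have helm: "\<forall>j\<le>2 * N. helmholtz_on (cell j) (if odd j then \<omega> / of_real vb else k) u"
  proof (intro allI impI)
    fix j assume "j \<le> 2 * N"
    show "helmholtz_on (cell j) (if odd j then \<omega> / of_real vb else k) u"
      by (rule helmholtz_on_plane[OF open_cell u[OF \<open>j \<le> 2 * N\<close>, unfolded wave_def]])
  qed
  have u0: "u x = plane_wave k (y (max 1 0)) (a 0) (b 0) x" if "x \<in> cell 0" for x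
    using u[of 0 x] that by (simp add: wave_def)
  have rad0: "(\<forall>x\<in>cell 0. - vector_derivative u (at x) - \<i> * k * u x = 0) \<longleftrightarrow> b 0 = 0"
    by (rule plane_radiation(1)[OF open_cell cell_nonempty[OF le0] u0 k])
  have uN: "u x = plane_wave k (y (max 1 (2 * N))) (a (2 * N)) (b (2 * N)) x" if "x \<in> cell (2 * N)" for x
    using u[of "2 * N" x] that by (simp add: wave_def)
  have radN: "(\<forall>x\<in>cell (2 * N). vector_derivative u (at x) - \<i> * k * u x = 0) \<longleftrightarrow> a (2 * N) = 0"
    by (rule plane_radiation(2)[OF open_cell cell_nonempty[OF order_refl] uN k])
  have trans: "transmits \<delta> u j \<longleftrightarrow> u (y (Suc j)) = a (Suc j) + b (Suc j) \<and> amplitude_step t \<sigma> k a b j"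
    if "j < 2 * N" for j
    unfolding t_def \<sigma>_def k_def
  proof (rule transmits_iff_amplitude_step[OF v \<omega> that])
    show "u x = plane_wave (if odd j then \<omega> / of_real vb else \<omega> / of_real v) (y (max 1 j)) (a j) (b j) x"
      if "x \<in> cell j" for x
      using u[of j x] that \<open>j < 2 * N\<close> unfolding wave_def k_def by linarith
    show "u x = plane_wave (if odd (Suc j) then \<omega> / of_real vb else \<omega> / of_real v) (y (max 1 (Suc j))) (a (Suc j)) (b (Suc j)) x"
      if "x \<in> cell (Suc j)" for x
      using u[of "Suc j" x] that \<open>j < 2 * N\<close> unfolding wave_def k_def by linarith
  qed
  show ?thesis
    unfolding scattering_solution_iff k_def[symmetric] rad0 radN using helm trans by auto
qed

lemma resonant_frequency_imp_amplitudes: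
  assumes v: "v > 0" "vb > 0" and \<omega>: "\<omega> \<noteq> 0"
    and k_def: "k = \<omega> / of_real v" and t_def: "t = travel_times (v / vb) xm xp"
    and \<sigma>_def: "\<sigma> = \<delta> / of_real (v / vb)"
    and res: "resonant_frequency N xm xp v vb \<delta> \<omega>"
  shows "\<exists>a b. resonant_amplitudes N t \<sigma> k a b"
proof -
  obtain u x where u: "scattering_solution N xm xp v vb \<delta> \<omega> u" and x: "u x \<noteq> 0"
    using res by (auto simp: resonant_frequency_def)
  have "\<exists>c d. \<forall>x\<in>cell j. u x = plane_wave (if odd j then \<omega> / of_real vb else k) (y (max 1 j)) c d x"
    if "j \<le> 2 * N" for j
  proof (rule helmholtz_on_imp_plane[OF _ convex_cell])
    show "helmholtz_on (cell j) (if odd j then \<omega> / of_real vb else k) u"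
      using u that unfolding scattering_solution_iff k_def by blast
    show "(if odd j then \<omega> / of_real vb else k) \<noteq> 0" using v \<omega> by (simp add: k_def)
  qed
  then obtain a b where "\<forall>j\<le>2 * N. \<forall>x\<in>cell j.
      u x = plane_wave (if odd j then \<omega> / of_real vb else k) (y (max 1 j)) (a j) (b j) x"
    by metis
  then have ab: "u x = wave k (\<omega> / of_real vb) a b j x" if "j \<le> 2 * N" "x \<in> cell j" for j x
    unfolding wave_def using that by blast
  have sol: "(\<forall>j<2 * N. u (y (Suc j)) = a (Suc j) + b (Suc j) \<and> amplitude_step t \<sigma> k a b j) \<and>
        b 0 = 0 \<and> a (2 * N) = 0"
    by (rule iffD1[OF scattering_solution_wave_iff[OF v \<omega> k_def t_def \<sigma>_def ab] u])
  have "\<exists>j\<le>2 * N. a j \<noteq> 0 \<or> b j \<noteq> 0"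
  proof (rule ccontr)
    assume contr: "\<not> ?thesis"
    have y0: "u (y (Suc j)) = 0" if "j < 2 * N" for j
      using sol contr that by auto
    have "x \<noteq> y j" if "1 \<le> j" "j \<le> 2 * N" for j
      using that x y0[of "j - 1"] by (cases j) auto
    then obtain j where j: "j \<le> 2 * N" "x \<in> cell j" by (rule cell_exhaust)
    then show False using ab[OF j] contr x by (simp add: wave_def plane_wave_def)
  qed
  with sol show ?thesis
    unfolding resonant_amplitudes_def by blast
qed

lemma amplitudes_imp_resonant_frequency:
  assumes v: "v > 0" "vb > 0" and \<omega>: "\<omega> \<noteq> 0"
    and k_def: "k = \<omega> / of_real v" and t_def: "t = travel_times (v / vb) xm xp"
    and \<sigma>_def: "\<sigma> = \<delta> / of_real (v / vb)"
    and ab: "resonant_amplitudes N t \<sigma> k a b"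
  shows "resonant_frequency N xm xp v vb \<delta> \<omega>"
proof -
  define u where "u x = wave k (\<omega> / of_real vb) a b (cell_index x) x" for x
  have u: "u x = wave k (\<omega> / of_real vb) a b j x" if "j \<le> 2 * N" "x \<in> cell j" for j x
    using cell_index_cell[OF that] by (simp add: u_def)
  have "u (y (Suc j)) = a (Suc j) + b (Suc j)" if "j < 2 * N" for j
    using cell_index_y[of "Suc j"] that by (simp add: u_def wave_def plane_anchor)
  moreover have "scattering_solution N xm xp v vb \<delta> \<omega> u \<longleftrightarrow>
      (\<forall>j<2 * N. u (y (Suc j)) = a (Suc j) + b (Suc j) \<and> amplitude_step t \<sigma> k a b j) \<and>
      b 0 = 0 \<and> a (2 * N) = 0"
    by (rule scattering_solution_wave_iff[OF v \<omega> k_def t_def \<sigma>_def u])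
  ultimately have "scattering_solution N xm xp v vb \<delta> \<omega> u"
    using ab by (simp add: resonant_amplitudes_def)
  moreover have "\<exists>x. u x \<noteq> 0"
  proof (rule ccontr)
    assume contr: "\<not> ?thesis"
    obtain j where j: "j \<le> 2 * N" "a j \<noteq> 0 \<or> b j \<noteq> 0"
      using ab by (auto simp: resonant_amplitudes_def)
    define \<kappa> where "\<kappa> = (if odd j then \<omega> / of_real vb else k)"
    have "\<kappa> \<noteq> 0" using v \<omega> by (simp add: \<kappa>_def k_def)
    obtain x where x: "x \<in> cell j" using cell_nonempty[OF j(1)] by blast
    have "plane_wave \<kappa> (y (max 1 j)) (a j) (b j) x = 0" if "x \<in> cell j" for x
      using u[OF j(1) that] contr by (simp add: wave_def \<kappa>_def)
    from plane_zero_imp[OF open_cell x this \<open>\<kappa> \<noteq> 0\<close>] show False using j(2) by simp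
  qed
  ultimately show ?thesis
    unfolding resonant_frequency_def by blast
qed

theorem resonant_frequency_iff_amplitudes:
  assumes "v > 0" "vb > 0" "\<omega> \<noteq> 0" "k = \<omega> / of_real v" "t = travel_times (v / vb) xm xp"
    "\<sigma> = \<delta> / of_real (v / vb)"
  shows "resonant_frequency N xm xp v vb \<delta> \<omega> \<longleftrightarrow> (\<exists>a b. resonant_amplitudes N t \<sigma> k a b)"
  using resonant_frequency_imp_amplitudes[OF assms] amplitudes_imp_resonant_frequency[OF assms]
  by blast

end

section \<open>Zeros of the resonance function\<close>

lemma travel_times_pos:
  assumes "resonator_chain N xm xp" "r > 0" "1 \<le> j" "j \<le> 2 * N - 1"
  shows "travel_times r xm xp j > 0"
proof -
  interpret resonator_array N xm xp using assms(1) by unfold_locales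
  have "y j < y (Suc j)" using assms(3,4) by (intro y_less_Suc) auto
  then show ?thesis using assms(2) by (auto simp: travel_times_def interface_def split: if_splits)
qed

definition path_weight :: "nat \<Rightarrow> complex \<Rightarrow> (nat \<Rightarrow> int) \<Rightarrow> complex" where
  "path_weight N \<sigma> \<alpha> = (-1) ^ (\<Sum>j=1..2 * N. j * sign_change \<alpha> j) *
     ((1 - \<sigma>) / (1 + \<sigma>)) ^ (\<Sum>j=1..2 * N. sign_change \<alpha> j)"

definition path_frequency :: "nat \<Rightarrow> (nat \<Rightarrow> real) \<Rightarrow> (nat \<Rightarrow> int) \<Rightarrow> real" where
  "path_frequency N t \<alpha> = (\<Sum>j=1..2 * N - 1. of_int (\<alpha> j) * t j)"

definition all_plus :: "nat \<Rightarrow> nat \<Rightarrow> int" where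
  "all_plus N j = (if j \<in> {1..2 * N - 1} then 1 else - 1)"

text \<open>The weights \<open>t j\<close> are positive, so flipping signs from \<open>-1\<close> to \<open>1\<close> increases the frequency. In
  particular the vectors whose free signs are all \<open>-1\<close> or all \<open>1\<close> have the extreme frequencies, and no
  other vector does.\<close>

lemma path_frequency_strict:
  assumes \<alpha>: "\<alpha> \<in> sign_vectors N" and \<beta>: "\<beta> \<in> sign_vectors N" and ne: "\<alpha> \<noteq> \<beta>"
    and le: "\<And>j. \<alpha> j \<le> \<beta> j" and t: "\<And>j. 1 \<le> j \<Longrightarrow> j \<le> 2 * N - 1 \<Longrightarrow> t j > 0"
  shows "path_frequency N t \<alpha> < path_frequency N t \<beta>"
proof -
  obtain j where j: "\<alpha> j \<noteq> \<beta> j" using ne by auto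
  have jin: "j \<in> {1..2 * N - 1}"
  proof (rule ccontr)
    assume "j \<notin> {1..2 * N - 1}"
    then have "\<alpha> j = -1" "\<beta> j = -1" using \<alpha> \<beta> unfolding sign_vectors_def by blast+
    then show False using j by simp
  qed
  have "\<alpha> j < \<beta> j" using j le[of j] by simp
  then have "of_int (\<alpha> j) * t j < of_int (\<beta> j) * t j"
    using t[of j] jin by (intro mult_strict_right_mono) auto
  then show ?thesis
    unfolding path_frequency_def using jin le t
    by (intro sum_strict_mono_ex1) (auto intro!: mult_right_mono less_imp_le)
qed

lemma exponential_sum_resonance:
  assumes "N \<ge> 1" "\<sigma> \<noteq> 1" "\<sigma> \<noteq> -1" and t: "\<And>j. 1 \<le> j \<Longrightarrow> j \<le> 2 * N - 1 \<Longrightarrow> t j > 0"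
  shows "exponential_sum (sign_vectors N) (path_weight N \<sigma>) (path_frequency N t) (\<lambda>_. -1) (all_plus N)"
proof -
  have \<rho>: "(1 - \<sigma>) / (1 + \<sigma>) \<noteq> 0" using assms(2,3) by (auto simp: add_eq_0_iff)
  have lo_in: "(\<lambda>_. -1) \<in> sign_vectors N" and hi_in: "all_plus N \<in> sign_vectors N"
    by (auto simp: sign_vectors_def all_plus_def)
  have lower: "-1 \<le> \<alpha> j" and upper: "\<alpha> j \<le> all_plus N j" if "\<alpha> \<in> sign_vectors N" for \<alpha> j
  proof -
    have "(j \<in> {1..2 * N - 1} \<longrightarrow> \<alpha> j = -1 \<or> \<alpha> j = 1) \<and> (j \<notin> {1..2 * N - 1} \<longrightarrow> \<alpha> j = -1)"
      using that unfolding sign_vectors_def by blast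
    then show "-1 \<le> \<alpha> j" "\<alpha> j \<le> all_plus N j" unfolding all_plus_def by presburger+
  qed
  have "all_plus N 1 = 1" using assms(1) by (simp add: all_plus_def)
  then have ne: "(\<lambda>_. -1) \<noteq> all_plus N" by (auto simp: fun_eq_iff intro!: exI[of _ 1])
  show ?thesis
  proof
    show "path_weight N \<sigma> (\<lambda>_. -1) \<noteq> 0" "path_weight N \<sigma> (all_plus N) \<noteq> 0"
      using \<rho> by (auto simp: path_weight_def)
    show "path_frequency N t (\<lambda>_. -1) < path_frequency N t (all_plus N)"
      by (rule path_frequency_strict[OF lo_in hi_in ne lower[OF hi_in] t])
    show "path_frequency N t (\<lambda>_. -1) < path_frequency N t \<alpha>"
      if "\<alpha> \<in> sign_vectors N" "\<alpha> \<noteq> (\<lambda>_. -1)" for \<alpha>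
      by (rule path_frequency_strict[OF lo_in that(1) that(2)[symmetric] lower[OF that(1)] t])
    show "path_frequency N t \<alpha> < path_frequency N t (all_plus N)"
      if "\<alpha> \<in> sign_vectors N" "\<alpha> \<noteq> all_plus N" for \<alpha>
      by (rule path_frequency_strict[OF that(1) hi_in that(2) upper[OF that(1)] t])
  qed (use lo_in hi_in finite_sign_vectors in auto)
qed

lemma path_frequency_range:
  "path_frequency N t (all_plus N) - path_frequency N t (\<lambda>_. -1) = 2 * (\<Sum>j=1..2 * N - 1. t j)"
  unfolding path_frequency_def all_plus_def sum_subtractf[symmetric] sum_distrib_left
  by (intro sum.cong) auto

lemma resonance_fun_nonzero_upper_half_plane:
  assumes "N \<ge> 1" "\<sigma> = of_real s" "s > 0" "Im k \<ge> 0" and t: "\<And>j. 1 \<le> j \<Longrightarrow> j \<le> 2 * N - 1 \<Longrightarrow> t j \<ge> 0"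
  shows "resonance_fun N t \<sigma> k \<noteq> 0"
proof -
  have "(1 - \<sigma>) / (1 + \<sigma>) = of_real ((1 - s) / (1 + s))"
    by (simp add: assms(2))
  moreover have "\<bar>(1 - s) / (1 + s)\<bar> < 1"
    using assms(3) by (simp add: abs_if field_simps)
  ultimately have "norm (layer_sum ((1 - \<sigma>) / (1 + \<sigma>)) t k (2 * N - 1) 1)
      < norm (layer_sum ((1 - \<sigma>) / (1 + \<sigma>)) t k (2 * N - 1) (-1))"
    using layer_sum_upper_half_plane[of "(1 - s) / (1 + s)" k "2 * N - 1" t] assms(4) t by simp
  then show ?thesis unfolding resonance_fun_eq_layer_sum[OF assms(1)] by auto
qed

lemma sin_scaled_zeros:
  fixes \<tau> :: real
  assumes "\<tau> \<noteq> 0"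
  shows "{k::complex. sin (of_real \<tau> * k) = 0} = range (\<lambda>n::int. of_real (of_int n * pi / \<tau>))"
  using assms by (auto simp: sin_eq_0 field_simps)

section \<open>Countably many resonances\<close>

context resonator_array
begin

text \<open>The frequency \<open>\<omega> = 0\<close>, for which layers do not carry plane waves in general, is set aside: a
  single point affects neither claim.\<close>

theorem countable_infinite_resonant_frequencies:
  assumes v: "v > 0" "vb > 0" and r: "r = v / vb" and \<sigma>: "\<sigma> = \<delta> / of_real r" "\<sigma> \<noteq> -1"
    and t: "t = travel_times r xm xp"
    and zeros: "countable {k. resonance_fun N t \<sigma> k = 0}" "infinite {k. resonance_fun N t \<sigma> k = 0}"
  shows "countable {\<omega>. resonant_frequency N xm xp v vb \<delta> \<omega>}"
    and "infinite {\<omega>. resonant_frequency N xm xp v vb \<delta> \<omega>}"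
proof -
  define Z where "Z = {k. \<exists>a b. resonant_amplitudes N t \<sigma> k a b}"
  have "r > 0" using v r by simp
  have t_pos: "t j > 0" if "1 \<le> j" "j \<le> 2 * N - 1" for j
    unfolding t using travel_times_pos[OF chain \<open>r > 0\<close> that] .
  have "countable Z \<and> infinite Z"
  proof (cases "\<sigma> = 0")
    case False
    then have "Z = {k. resonance_fun N t \<sigma> k = 0}"
      unfolding Z_def using resonant_amplitudes_iff[OF _ \<sigma>(2) N_pos] by blast
    then show ?thesis using zeros by simp
  next
    case True
    have sin_zeros: "{k::complex. sin (of_real (t j) * k) = 0} = range (\<lambda>n::int. of_real (of_int n * pi / t j))"
      if "1 \<le> j" "j \<le> 2 * N - 1" for j
      using t_pos[OF that] by (intro sin_scaled_zeros) auto
    have "Z \<subseteq> (\<Union>j\<in>{1..2 * N - 1}. {k. sin (of_real (t j) * k) = 0})"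
      unfolding Z_def True using resonant_amplitudes_decoupled_imp by blast
    moreover have "countable (\<Union>j\<in>{1..2 * N - 1}. {k::complex. sin (of_real (t j) * k) = 0})"
      by (intro countable_UN) (auto simp: sin_zeros)
    ultimately have "countable Z" by (rule countable_subset)
    moreover have "infinite Z"
    proof -
      have "inj (\<lambda>n::int. complex_of_real (of_int n * pi / t 1))"
      proof -
        have "t 1 \<noteq> 0" using t_pos[of 1] N_pos by force
        then show ?thesis by (intro injI) (simp add: field_simps)
      qed
      then have "infinite (range (\<lambda>n::int. complex_of_real (of_int n * pi / t 1)))"
        using finite_imageD infinite_UNIV_int by blast
      moreover have "{k::complex. sin (of_real (t 1) * k) = 0} = range (\<lambda>n::int. of_real (of_int n * pi / t 1))"
        by (rule sin_zeros) (use N_pos in auto)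
      ultimately have "infinite {k::complex. sin (of_real (t 1) * k) = 0}" by argo
      moreover have "{k::complex. sin (of_real (t 1) * k) = 0} \<subseteq> Z"
        unfolding Z_def True using resonant_amplitudes_decoupled[OF N_pos] by blast
      ultimately show ?thesis using finite_subset by blast
    qed
    ultimately show ?thesis by blast
  qed
  then have Z: "countable Z" "infinite Z" by auto
  have iff: "resonant_frequency N xm xp v vb \<delta> \<omega> \<longleftrightarrow> \<omega> / of_real v \<in> Z" if "\<omega> \<noteq> 0" for \<omega>
    using resonant_frequency_iff_amplitudes[OF v that refl t[unfolded r] \<sigma>(1)[unfolded r]] by (simp add: Z_def)
  have "{\<omega>. resonant_frequency N xm xp v vb \<delta> \<omega>} \<subseteq> insert 0 ((\<lambda>k. of_real v * k) ` Z)"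
  proof
    fix \<omega> assume "\<omega> \<in> {\<omega>. resonant_frequency N xm xp v vb \<delta> \<omega>}"
    then have "\<omega> = 0 \<or> \<omega> / of_real v \<in> Z" using iff by auto
    moreover have "\<omega> = of_real v * (\<omega> / of_real v)" using v by simp
    ultimately show "\<omega> \<in> insert 0 ((\<lambda>k. of_real v * k) ` Z)" by blast
  qed
  then show "countable {\<omega>. resonant_frequency N xm xp v vb \<delta> \<omega>}"
    by (rule countable_subset) (intro countable_insert countable_image Z(1))
  have "infinite ((\<lambda>k. of_real v * k) ` (Z - {0}))"
    using Z(2) v by (subst finite_image_iff) (auto intro!: inj_onI)
  moreover have "(\<lambda>k. of_real v * k) ` (Z - {0}) \<subseteq> {\<omega>. resonant_frequency N xm xp v vb \<delta> \<omega>}"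
    using iff v by auto
  ultimately show "infinite {\<omega>. resonant_frequency N xm xp v vb \<delta> \<omega>}"
    using finite_subset by blast
qed

end

theorem theorem3p3:
  fixes N :: nat and xm xp :: "nat \<Rightarrow> real" and v vb r :: real and \<delta> \<sigma> :: complex
    and t :: "nat \<Rightarrow> real" and f :: "complex \<Rightarrow> complex"
  assumes "resonator_chain N xm xp"
    and "v > 0" and "vb > 0"
    and "r = v / vb"
    and "\<sigma> = \<delta> / of_real r"
    and "\<sigma> \<noteq> 1" and "\<sigma> \<noteq> -1"
    and "t = travel_times r xm xp"
    and "f = resonance_fun N t \<sigma>"
  shows "(\<exists>C1 C2. zeros_in_strip f C1 C2)
    \<and> (\<delta> \<in> \<real> \<and> Re \<delta> > 0 \<longrightarrow> (\<exists>C1. zeros_in_strip f C1 0))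
    \<and> (\<forall>C1 C2. zeros_in_strip f C1 C2 \<longrightarrow>
         ((\<lambda>(x1, x2). of_int (zero_count f C1 C2 x1 x2) / (x2 - x1)) \<longlongrightarrow>
            (\<Sum>j=1..2 * N - 1. t j) / pi)
           (filtercomap (\<lambda>(x1, x2). x2 - x1) at_top))
    \<and> countable {k. f k = 0} \<and> infinite {k. f k = 0}
    \<and> countable {\<omega>. resonant_frequency N xm xp v vb \<delta> \<omega>}
    \<and> infinite {\<omega>. resonant_frequency N xm xp v vb \<delta> \<omega>}"
proof -
  interpret resonator_array N xm xp using assms(1) by unfold_locales
  have "r > 0" using assms(2,3,4) by simp
  have t_pos: "t j > 0" if "1 \<le> j" "j \<le> 2 * N - 1" for j
    unfolding assms(8) using travel_times_pos[OF assms(1) \<open>r > 0\<close> that] .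
  interpret f: exponential_sum "sign_vectors N" "path_weight N \<sigma>" "path_frequency N t" "\<lambda>_. -1" "all_plus N"
    by (rule exponential_sum_resonance[OF N_pos assms(6,7) t_pos])
  have g: "f.g = f"
    unfolding assms(9) by (auto simp: fun_eq_iff f.g_def resonance_fun_def path_weight_def path_frequency_def)
  have density: "(path_frequency N t (all_plus N) - path_frequency N t (\<lambda>_. -1)) / (2 * pi)
      = (\<Sum>j=1..2 * N - 1. t j) / pi"
    unfolding path_frequency_range by simp
  obtain M where M: "M > 0" "\<And>z. f z = 0 \<Longrightarrow> \<bar>Im z\<bar> < M"
    using f.zeros_in_strip_symmetric unfolding g by blast
  have strip: "zeros_in_strip f (- M) M"
    using M(2) by (fastforce simp: zeros_in_strip_def abs_less_iff)
  have lower: "zeros_in_strip f (- M) 0" if "\<delta> \<in> \<real>" "Re \<delta> > 0"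
  proof -
    have "\<sigma> = of_real (Re \<delta> / r)" using that(1) assms(5) by (simp add: complex_eq_iff complex_is_Real_iff)
    moreover have "Re \<delta> / r > 0" using that(2) \<open>r > 0\<close> by simp
    ultimately have "Im k < 0" if "f k = 0" for k
      using resonance_fun_nonzero_upper_half_plane[OF N_pos, of \<sigma> "Re \<delta> / r" k t] t_pos that assms(9)
      by (meson less_imp_le not_le)
    then show ?thesis using strip by (auto simp: zeros_in_strip_def)
  qed
  have zeros: "countable {k. f k = 0}" "infinite {k. f k = 0}"
    using f.countable_zeros f.infinite_zeros unfolding g by auto
  note frequencies = countable_infinite_resonant_frequencies[OF assms(2,3,4,5,7,8)
      zeros[unfolded assms(9)]]
  show ?thesis
    using strip lower f.zero_density[unfolded g density] zeros frequencies by blast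
qed

end
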